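(* Let $f\in\mathcal S_{\mathbb H}$, $f\ne0$, and let $V\subset\mathbb B_1$ be a similarity class containing zeros of $f$. Then there exist unique finite Blaschke products $B^f_{\boldsymbol\ell,V}$ and $B^f_{\boldsymbol r,V}$ with all zeros in $V$ such that $$f=B^f_{\boldsymbol\ell,V}\cdot H_V=G_V\cdot B^f_{\boldsymbol r,V}$$ for some $H_V,G_V\in\mathcal S_{\mathbb H}$ having no zeros in $V$. More precisely: (1) If $V=\{x\}$ where $x$ is a real zero of $f$ of multiplicity $\pi$, then $B^f_{\boldsymbol\ell,\{x\}}=B^f_{\boldsymbol r,\{x\}}={\bf b}_x^\pi$. (2) If $V$ is non-real and $m_s(V;ff^\sharp)=2m_s(V;f)=2\kappa>0$, then $B^f_{\boldsymbol\ell,V}=B^f_{\boldsymbol r,V}=\mathcal B_V^\kappa$. (3) If $V$ is non-real, $m_s(V;f)=\kappa\ge0$ and $m_s(V;ff^\sharp)-2m_s(V;f)=k>0$, then there exist unique spherical chains $\boldsymbol\alpha=(\alpha_1,\dots,\alpha_k)$ and $\widetilde{\boldsymbol\alpha}=(\widetilde\alpha_1,\dots,\widetilde\alpha_k)$ in $V$ such that $$B^f_{\boldsymbol\ell,V}=\mathcal B_V^\kappa\cdot{\bf b}_{\alpha_1}\cdots{\bf b}_{\alpha_k}\quad\text{and}\quad B^f_{\boldsymbol r,V}={\bf b}_{\widetilde\alpha_k}\cdots{\bf b}_{\widetilde\alpha_1}\mathcal B_V^\kappa.$$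
   Context: $\mathbb H$ is the skew field of real quaternions with conjugation $\alpha\mapsto\overline\alpha$ and modulus $|\cdot|$; $\mathbb B_1=\{\alpha\in\mathbb H:|\alpha|<1\}$. The similarity class of $\alpha$ is $[\alpha]=\{h\alpha h^{-1}:h\in\mathbb H\setminus\{0\}\}$; it is a singleton if $\alpha$ is real. $\mathbb H[[z]]$ is the ring of formal power series in a variable $z$ commuting with the quaternionic coefficients, with the Cauchy product $(fg)_k=\sum_{\ell=0}^kf_\ell g_{k-\ell}$. For $f=\sum_kf_kz^k$ put $f^\sharp=\sum_k\overline{f_k}z^k$; then $ff^\sharp=f^\sharp f\in\mathbb R[[z]]$. $\mathcal H_1$ is the ring of power series with $\limsup_k|f_k|^{1/k}\le1$. For $f\in\mathcal H_1$ and $\gamma\in\mathbb B_1$, $f^{\boldsymbol{e_\ell}}(\gamma)=\sum_k\gamma^kf_k$ and $f^{\boldsymbol{e_r}}(\gamma)=\sum_kf_k\gamma^k$; $\gamma$ is a left (right) zero of $f$ if $f^{\boldsymbol{e_\ell}}(\gamma)=0$ (resp. $f^{\boldsymbol{e_r}}(\gamma)=0$). "Zeros" means left or right zeros. The Schur class $\mathcal S_{\mathbb H}$ is the set of $f\in\mathcal H_1$ with $|f^{\boldsymbol{e_\ell}}(\gamma)|\le1$ for all $\gamma\in\mathbb B_1$ (equivalently, $|f^{\boldsymbol{e_r}}(\gamma)|\le1$ for all $\gamma\in\mathbb B_1$). For a non-real class $V=[\alpha]$ put $\mathcal X_V(z)=(z-\alpha)(z-\overline\alpha)=z^2-2z\,\mathrm{Re}(\alpha)+|\alpha|^2$.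 If $V\subset\mathbb B_1$ and $f\in\mathcal H_1$, $f\neq 0$, then $V$ is a spherical zero of $f$ if $f=\mathcal X_Vg$ for some $g\in\mathcal H_1$, and the spherical multiplicity $m_s(V;f)$ is the largest integer $k\ge0$ such that $f=\mathcal X_V^kg$ for some $g\in\mathcal H_1$. A real $x\in(-1,1)$ is a zero of $f$ of multiplicity $\pi$ if $f=(z-x)^\pi g$ with $g\in\mathcal H_1$ having no zero at $x$. For $\alpha\in\mathbb B_1$, the Blaschke factor is ${\bf b}_\alpha(z)=(z-\alpha)\sum_{k\ge0}\overline\alpha^kz^k$. A finite Blaschke product of degree $n$ is a power series ${\bf b}_{\alpha_1}\cdots{\bf b}_{\alpha_n}\phi$ with $\alpha_1,\dots,\alpha_n\in\mathbb B_1$, $\phi\in\mathbb H$, $|\phi|=1$. For a non-real class $V=[\alpha]\subset\mathbb B_1$, $\mathcal B_V={\bf b}_\alpha{\bf b}_{\overline\alpha}\in\mathbb R[[z]]$ (independent of the choice of $\alpha\in V$). A spherical chain in $V$ is a finite ordered collection $(\alpha_1,\dots,\alpha_k)$ of elements of $V$ with $\alpha_{j+1}\ne\overline{\alpha_j}$ for $j=1,\dots,k-1$.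
   Formalization: Uniqueness of the finite Blaschke products is false if a unimodular constant φ is allowed (f = z = (zu)u⁻¹); what is proved is uniqueness among products with φ = 1, and uniqueness up to a unimodular constant factor (on the right for the left factor, on the left for the right factor) in general. *)

theory Defs
  imports "HOL-Analysis.Analysis" "HOL-Computational_Algebra.Formal_Power_Series"
begin

section \<open>Real quaternions\<close>

datatype quat = Quat (qRe: real) (qIm1: real) (qIm2: real) (qIm3: real)

lemma quat_eq_iff:
  "x = y \<longleftrightarrow> qRe x = qRe y \<and> qIm1 x = qIm1 y \<and> qIm2 x = qIm2 y \<and> qIm3 x = qIm3 y"
  by (cases x; cases y) auto

instantiation quat :: ring_1
begin

definition "0 = Quat 0 0 0 0"
definition "1 = Quat 1 0 0 0"
definition "x + y = Quat (qRe x + qRe y) (qIm1 x + qIm1 y) (qIm2 x + qIm2 y) (qIm3 x + qIm3 y)"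
definition "x - y = Quat (qRe x - qRe y) (qIm1 x - qIm1 y) (qIm2 x - qIm2 y) (qIm3 x - qIm3 y)"
definition "- x = Quat (- qRe x) (- qIm1 x) (- qIm2 x) (- qIm3 x)"
definition "x * y = Quat
  (qRe x * qRe y - qIm1 x * qIm1 y - qIm2 x * qIm2 y - qIm3 x * qIm3 y)
  (qRe x * qIm1 y + qIm1 x * qRe y + qIm2 x * qIm3 y - qIm3 x * qIm2 y)
  (qRe x * qIm2 y - qIm1 x * qIm3 y + qIm2 x * qRe y + qIm3 x * qIm1 y)
  (qRe x * qIm3 y + qIm1 x * qIm2 y - qIm2 x * qIm1 y + qIm3 x * qRe y)"

instance
  by standard
    (auto simp: quat_eq_iff zero_quat_def one_quat_def plus_quat_def minus_quat_def
      uminus_quat_def times_quat_def algebra_simps)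

end

lemmas quat_ring_defs =
  zero_quat_def one_quat_def plus_quat_def minus_quat_def uminus_quat_def times_quat_def

definition qcnj :: "quat \<Rightarrow> quat"
  where "qcnj x = Quat (qRe x) (- qIm1 x) (- qIm2 x) (- qIm3 x)"

instantiation quat :: real_algebra_1
begin

definition "scaleR r x = Quat (r * qRe x) (r * qIm1 x) (r * qIm2 x) (r * qIm3 x)"

instance
  by standard (auto simp: quat_eq_iff quat_ring_defs scaleR_quat_def algebra_simps)

end

instantiation quat :: euclidean_space
begin

definition "inner x y = qRe x * qRe y + qIm1 x * qIm1 y + qIm2 x * qIm2 y + qIm3 x * qIm3 y"
definition "norm x = sqrt ((qRe x)\<^sup>2 + (qIm1 x)\<^sup>2 + (qIm2 x)\<^sup>2 + (qIm3 x)\<^sup>2)" for x :: quat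
definition "sgn x = x /\<^sub>R norm x" for x :: quat
definition "dist x y = norm (x - y)" for x y :: quat
definition [code del]:
  "(uniformity :: (quat \<times> quat) filter) = (INF e\<in>{0<..}. principal {(x, y). dist x y < e})"
definition [code del]:
  "open (U :: quat set) \<longleftrightarrow> (\<forall>x\<in>U. eventually (\<lambda>(x', y). x' = x \<longrightarrow> y \<in> U) uniformity)"
definition "Basis = {Quat 1 0 0 0, Quat 0 1 0 0, Quat 0 0 1 0, Quat 0 0 0 1}"

instance
proof
  fix x y z :: quat and r :: real
  show "inner x y = inner y x" by (simp add: inner_quat_def mult.commute)
  show "inner (x + y) z = inner x z + inner y z"
    by (simp add: inner_quat_def plus_quat_def algebra_simps)
  show "inner (scaleR r x) y = r * inner x y"
    by (simp add: inner_quat_def scaleR_quat_def algebra_simps)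
  show "0 \<le> inner x x" by (simp add: inner_quat_def)
  show "inner x x = 0 \<longleftrightarrow> x = 0"
    by (auto simp: inner_quat_def quat_eq_iff zero_quat_def add_nonneg_eq_0_iff)
  show "norm x = sqrt (inner x x)" by (simp add: inner_quat_def norm_quat_def power2_eq_square)
next
  fix x :: quat
  show "(\<forall>u\<in>Basis. inner x u = 0) \<longleftrightarrow> x = 0"
    by (cases x) (simp add: inner_quat_def Basis_quat_def zero_quat_def)
qed (auto simp: sgn_quat_def dist_quat_def uniformity_quat_def open_quat_def
      Basis_quat_def inner_quat_def)

end

instantiation quat :: real_normed_div_algebra
begin

definition "inverse x = qcnj x /\<^sub>R (norm x)\<^sup>2"
definition "x div y = x * inverse y" for x y :: quat

instance
proof
  fix x y :: quat
  have *: "(norm z)\<^sup>2 = (qRe z)\<^sup>2 + (qIm1 z)\<^sup>2 + (qIm2 z)\<^sup>2 + (qIm3 z)\<^sup>2" for z :: quat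
    by (simp add: norm_quat_def)
  show "norm (x * y) = norm x * norm y"
    unfolding norm_quat_def real_sqrt_mult [symmetric]
    by (rule arg_cong [where f = sqrt]) (simp add: times_quat_def power2_eq_square algebra_simps)
  have **: "x * qcnj x = (norm x)\<^sup>2 *\<^sub>R 1" "qcnj x * x = (norm x)\<^sup>2 *\<^sub>R 1"
    by (auto simp: * [unfolded power2_eq_square] quat_eq_iff quat_ring_defs scaleR_quat_def
        qcnj_def power2_eq_square)
  show "inverse x * x = 1" "x * inverse x = 1" if "x \<noteq> 0"
    using that by (auto simp: inverse_quat_def **)
  show "x div y = x * inverse y" by (simp add: divide_quat_def)
  show "inverse (0 :: quat) = 0"
    by (simp add: inverse_quat_def quat_eq_iff zero_quat_def qcnj_def scaleR_quat_def)
qed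

end

definition sim_class :: "quat \<Rightarrow> quat set"
  where "sim_class a = {h * a * inverse h | h. h \<noteq> 0}"

definition nonreal_class :: "quat set \<Rightarrow> bool"
  where "nonreal_class V \<longleftrightarrow> (\<exists>a. a \<notin> \<real> \<and> V = sim_class a)"


section \<open>Power series over the quaternions\<close>

definition fps_sharp :: "quat fps \<Rightarrow> quat fps"
  where "fps_sharp f = Abs_fps (\<lambda>k. qcnj (fps_nth f k))"

definition H1 :: "quat fps set"
  where "H1 = {f. limsup (\<lambda>k. ereal (root k (norm (fps_nth f k)))) \<le> 1}"

definition eval_left :: "quat fps \<Rightarrow> quat \<Rightarrow> quat"
  where "eval_left f c = (\<Sum>k. c ^ k * fps_nth f k)"

definition eval_right :: "quat fps \<Rightarrow> quat \<Rightarrow> quat"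
  where "eval_right f c = (\<Sum>k. fps_nth f k * c ^ k)"

definition has_zero_at :: "quat fps \<Rightarrow> quat \<Rightarrow> bool"
  where "has_zero_at f c \<longleftrightarrow> norm c < 1 \<and> (eval_left f c = 0 \<or> eval_right f c = 0)"

definition schur_class :: "quat fps set"
  where "schur_class = {f \<in> H1. \<forall>c. norm c < 1 \<longrightarrow> norm (eval_left f c) \<le> 1}"

text \<open>The following quadratic and, below, \<open>blaschke_class V\<close> do not depend on the
  representative; see \<open>class_poly_eq\<close> and \<open>blaschke_class_eq\<close>.\<close>

definition class_poly :: "quat set \<Rightarrow> quat fps"
  where "class_poly V =
    (let a = (SOME a. a \<in> V) in (fps_X - fps_const a) * (fps_X - fps_const (qcnj a)))"

text \<open>Only meaningful for \<open>f \<in> H1\<close>, \<open>f \<noteq> 0\<close> and non-real \<open>V\<close> inside the unit ball;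
  then the exponents in question are bounded.\<close>

definition sph_mult :: "quat set \<Rightarrow> quat fps \<Rightarrow> nat"
  where "sph_mult V f = (GREATEST k. \<exists>g\<in>H1. f = class_poly V ^ k * g)"

definition real_zero_mult :: "quat fps \<Rightarrow> real \<Rightarrow> nat \<Rightarrow> bool"
  where "real_zero_mult f x p \<longleftrightarrow>
    (\<exists>g\<in>H1. f = (fps_X - fps_const (of_real x)) ^ p * g \<and> \<not> has_zero_at g (of_real x))"


section \<open>Finite Blaschke products\<close>

definition blaschke :: "quat \<Rightarrow> quat fps"
  where "blaschke a = (fps_X - fps_const a) * Abs_fps (\<lambda>k. qcnj a ^ k)"

definition finite_blaschke :: "quat fps set"
  where "finite_blaschke =
    {prod_list (map blaschke as) * fps_const u | as u. (\<forall>a\<in>set as. norm a < 1) \<and> norm u = 1}"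

text \<open>In a factorization \<open>f = B * H\<close> a unimodular constant \<open>u\<close> can always be moved between the
  factors, \<open>B * H = (B * u) * (inverse u * H)\<close>. Hence a Blaschke factor is unique only up to
  such a constant, and unique outright among the products with constant factor \<open>1\<close>.\<close>

definition normalized_finite_blaschke :: "quat fps set"
  where "normalized_finite_blaschke =
    {prod_list (map blaschke as) | as. \<forall>a\<in>set as. norm a < 1}"

definition blaschke_class :: "quat set \<Rightarrow> quat fps"
  where "blaschke_class V = (let a = (SOME a. a \<in> V) in blaschke a * blaschke (qcnj a))"

definition spherical_chain :: "quat set \<Rightarrow> quat list \<Rightarrow> bool"
  where "spherical_chain V as \<longleftrightarrow>
    set as \<subseteq> V \<and> (\<forall>j. Suc j < length as \<longrightarrow> as ! Suc j \<noteq> qcnj (as ! j))"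

definition left_blaschke_factor :: "quat set \<Rightarrow> quat fps \<Rightarrow> quat fps \<Rightarrow> bool"
  where "left_blaschke_factor V f B \<longleftrightarrow>
    B \<in> finite_blaschke \<and> {c. has_zero_at B c} \<subseteq> V \<and>
    (\<exists>H\<in>schur_class. (\<forall>c\<in>V. \<not> has_zero_at H c) \<and> f = B * H)"

definition right_blaschke_factor :: "quat set \<Rightarrow> quat fps \<Rightarrow> quat fps \<Rightarrow> bool"
  where "right_blaschke_factor V f B \<longleftrightarrow>
    B \<in> finite_blaschke \<and> {c. has_zero_at B c} \<subseteq> V \<and>
    (\<exists>G\<in>schur_class. (\<forall>c\<in>V. \<not> has_zero_at G c) \<and> f = G * B)"


section \<open>Independence of the representative\<close>

lemma self_in_sim_class: "a \<in> sim_class a"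
  unfolding sim_class_def by (force intro: exI [of _ 1])

lemma quat_mult_qcnj: "a * qcnj a = of_real ((norm a)\<^sup>2)" "qcnj a * a = of_real ((norm a)\<^sup>2)"
  by (simp_all add: of_real_def norm_quat_def quat_eq_iff quat_ring_defs scaleR_quat_def qcnj_def)
    (simp_all add: power2_eq_square)

lemma quat_add_qcnj: "a + qcnj a = of_real (2 * qRe a)"
  by (auto simp: of_real_def quat_eq_iff quat_ring_defs scaleR_quat_def qcnj_def)

lemma qRe_mult_commute: "qRe (a * b) = qRe (b * a)"
  by (simp add: times_quat_def)

lemma sim_class_invariants:
  assumes "b \<in> sim_class a"
  shows "qRe b = qRe a" "norm b = norm a"
proof -
  from assms obtain h where h: "h \<noteq> 0" "b = h * a * inverse h"
    by (auto simp: sim_class_def)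
  show "qRe b = qRe a"
    using h by (metis qRe_mult_commute left_inverse mult.assoc mult_1)
  show "norm b = norm a"
    using h by (simp add: norm_mult norm_inverse)
qed

lemma quadratic_eq:
  "(fps_X - fps_const a) * (fps_X - fps_const (qcnj a)) =
    fps_X\<^sup>2 - fps_const (of_real (2 * qRe a)) * fps_X + fps_const (of_real ((norm a)\<^sup>2))"
proof -
  have "(fps_X - fps_const a) * (fps_X - fps_const (qcnj a)) =
      fps_X\<^sup>2 - fps_const (a + qcnj a) * fps_X + fps_const (a * qcnj a)"
    by (simp add: algebra_simps power2_eq_square fps_mult_fps_X_commute [of "fps_const _"]
        flip: fps_const_add fps_const_mult)
  then show ?thesis by (simp add: quat_mult_qcnj quat_add_qcnj)
qed

lemma class_poly_eq:
  assumes "V = sim_class c" "a \<in> V"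
  shows "class_poly V = (fps_X - fps_const a) * (fps_X - fps_const (qcnj a))"
    and "class_poly V =
      fps_X\<^sup>2 - fps_const (of_real (2 * qRe a)) * fps_X + fps_const (of_real ((norm a)\<^sup>2))"
proof -
  define b where "b = (SOME a. a \<in> V)"
  have "b \<in> V" unfolding b_def using assms(2) by (rule someI)
  then have "qRe b = qRe a" "norm b = norm a"
    using assms sim_class_invariants by metis+
  then show "class_poly V = (fps_X - fps_const a) * (fps_X - fps_const (qcnj a))"
    unfolding class_poly_def b_def [symmetric] Let_def quadratic_eq by simp
  then show "class_poly V =
      fps_X\<^sup>2 - fps_const (of_real (2 * qRe a)) * fps_X + fps_const (of_real ((norm a)\<^sup>2))"
    by (simp only: quadratic_eq)
qed

lemma geometric_inverse:
  fixes a :: quat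
  shows "Abs_fps (\<lambda>k. a ^ k) * (1 - fps_const a * fps_X) = 1"
    and "(1 - fps_const a * fps_X) * Abs_fps (\<lambda>k. a ^ k) = 1"
proof -
  have 1: "fps_nth (f * (fps_const a * fps_X)) n =
      (if n = 0 then 0 else fps_nth f (n - 1) * a)" for f n
    by (simp add: fps_mult_fps_X_commute mult.assoc [symmetric])
  show "Abs_fps (\<lambda>k. a ^ k) * (1 - fps_const a * fps_X) = 1"
    by (rule fps_ext) (auto simp: 1 right_diff_distrib power_Suc2 [symmetric] simp del: power_Suc)
  show "(1 - fps_const a * fps_X) * Abs_fps (\<lambda>k. a ^ k) = 1"
    by (rule fps_ext) (auto simp: left_diff_distrib mult.assoc power_Suc [symmetric]
        simp del: power_Suc)
qed

lemma blaschke_pair_eq: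
  "blaschke a * blaschke (qcnj a) *
     (1 - fps_const (of_real (2 * qRe a)) * fps_X + fps_const (of_real ((norm a)\<^sup>2)) * fps_X\<^sup>2) =
   (fps_X - fps_const a) * (fps_X - fps_const (qcnj a))"
    (is "_ * ?R = _")
proof -
  have swap: "fps_X * (fps_const b * g) = fps_const b * (fps_X * g)" for b and g :: "quat fps"
    by (metis fps_mult_fps_X_commute mult.assoc)
  have "(1 - fps_const a * fps_X) * (1 - fps_const (qcnj a) * fps_X) =
      1 - fps_const (a + qcnj a) * fps_X + fps_const (a * qcnj a) * fps_X\<^sup>2"
    by (simp add: algebra_simps power2_eq_square swap mult.assoc
        flip: fps_const_add fps_const_mult)
  then have R: "?R = (1 - fps_const a * fps_X) * (1 - fps_const (qcnj a) * fps_X)"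
    by (simp add: quat_mult_qcnj quat_add_qcnj)
  define E where "E = (\<lambda>a :: quat. Abs_fps (\<lambda>k. a ^ k))"
  have cc: "qcnj (qcnj a) = a" by (simp add: qcnj_def)
  have comm: "(fps_X - fps_const b) * (1 - fps_const b * fps_X) =
      (1 - fps_const b * fps_X) * (fps_X - fps_const b)" for b :: quat
    by (simp add: algebra_simps swap fps_mult_fps_X_commute [of "fps_const _"])
  have "blaschke a * blaschke (qcnj a) * ?R =
      (fps_X - fps_const a) * E (qcnj a) * (fps_X - fps_const (qcnj a)) *
      (E a * (1 - fps_const a * fps_X)) * (1 - fps_const (qcnj a) * fps_X)"
    unfolding R blaschke_def E_def cc by (simp only: mult.assoc)
  also have "\<dots> = (fps_X - fps_const a) * E (qcnj a) *
      ((fps_X - fps_const (qcnj a)) * (1 - fps_const (qcnj a) * fps_X))"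
    unfolding E_def geometric_inverse by (simp only: mult.assoc mult_1_right)
  also have "\<dots> = (fps_X - fps_const a) * (E (qcnj a) * (1 - fps_const (qcnj a) * fps_X)) *
      (fps_X - fps_const (qcnj a))"
    unfolding comm by (simp only: mult.assoc)
  finally show ?thesis
    unfolding E_def geometric_inverse by simp
qed

lemma blaschke_class_eq:
  assumes "V = sim_class c" "a \<in> V"
  shows "blaschke_class V = blaschke a * blaschke (qcnj a)"
proof -
  define b where "b = (SOME a. a \<in> V)"
  have "b \<in> V" unfolding b_def using assms(2) by (rule someI)
  then have inv: "qRe b = qRe a" "norm b = norm a"
    using assms sim_class_invariants by metis+
  let ?R = "1 - fps_const (of_real (2 * qRe a)) * fps_X +
      fps_const (of_real ((norm a)\<^sup>2)) * fps_X\<^sup>2 :: quat fps"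
  have "fps_nth ?R 0 \<noteq> 0" by (simp add: power2_eq_square)
  then have nz: "?R \<noteq> 0" by (metis fps_zero_nth)
  have "blaschke b * blaschke (qcnj b) * ?R = blaschke a * blaschke (qcnj a) * ?R"
    using blaschke_pair_eq [of a] blaschke_pair_eq [of b] unfolding inv quadratic_eq by simp
  then have "blaschke b * blaschke (qcnj b) = blaschke a * blaschke (qcnj a)"
    using nz mult_right_cancel by blast
  then show ?thesis
    unfolding blaschke_class_def b_def [symmetric] Let_def .
qed

end

theory Submission
  imports Defs
begin

text \<open>A power series lies in the Schur class iff multiplication by it, from the left or equivalently
  from the right, is a contraction on square summable coefficient sequences. In this form it is
  immediate that the Schur class is closed under products and under \<open>fps_sharp\<close>, and, since
  Blaschke factors act isometrically, that a Blaschke factor \<open>blaschke a\<close> can be split off at every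
  left zero \<open>a\<close> within the Schur class. Splitting off factors with zeros in \<open>V\<close> ends because the
  lowest nonzero coefficient of \<open>f\<close> is at most \<open>(norm a) ^ n\<close> after \<open>n\<close> steps
  (if \<open>V = {0}\<close>, then \<open>n\<close> is at most the order of \<open>f\<close> at 0). For uniqueness,
  if two factorizations begin with different factors, then \<open>f\<close> has two left zeros in \<open>V\<close>, hence is
  divisible by the central factor \<open>blaschke_class V\<close>, which both products can be rewritten to
  contain. The multiplicities come from the central series \<open>f * fps_sharp f\<close>, and the right-hand
  factorizations from \<open>fps_sharp\<close>, which reverses products.\<close>


section \<open>Quaternions and similarity classes\<close>

text \<open>The obstacle is that pointwise bounds do not divide: a bound on
  \<open>blaschke a * h\<close> says little about \<open>h\<close> where the factor is small, and
  left values of a product involve conjugated points. Norms of coefficient sequences take the place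
  of a maximum principle, and they make the two sides symmetric. Noncommutativity enters in three
  more places. Left and right zeros differ, but \<open>f\<close> has a zero of either kind in a
  class in the ball exactly when the central series \<open>f * fps_sharp f\<close> vanishes there. A
  product does not determine its factors: \<open>blaschke b * blaschke (qcnj b)\<close> is the same
  for every \<open>b\<close> in a class, and spherical chains exclude exactly this ambiguity.
  Finally, \<open>k\<close> factors with zeros in \<open>V\<close> have norm series
  \<open>blaschke_class V ^ k\<close> in whatever order they stand, while a central power
  \<open>blaschke_class V ^ n\<close> accounts for \<open>2 * n\<close> factors; this is why the
  chain length is the multiplicity of \<open>f * fps_sharp f\<close> minus twice that of
  \<open>f\<close>.\<close>

lemma qcnj_simps [simp]:
  "qcnj (qcnj x) = x" "norm (qcnj x) = norm x" "qcnj 0 = 0" "qcnj 1 = 1" "qRe (qcnj x) = qRe x"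
  by (simp_all add: qcnj_def norm_quat_def quat_eq_iff quat_ring_defs)

lemma qcnj_add: "qcnj (x + y) = qcnj x + qcnj y"
  and qcnj_diff: "qcnj (x - y) = qcnj x - qcnj y"
  and qcnj_mult: "qcnj (x * y) = qcnj y * qcnj x"
  and qcnj_scaleR: "qcnj (r *\<^sub>R x) = r *\<^sub>R qcnj x"
  by (simp_all add: qcnj_def quat_eq_iff quat_ring_defs scaleR_quat_def)

lemma qcnj_power: "qcnj (x ^ k) = qcnj x ^ k"
  by (induction k) (simp_all add: qcnj_mult power_commutes)

lemma qcnj_eq_0_iff [simp]: "qcnj x = 0 \<longleftrightarrow> x = 0"
  by (metis qcnj_simps(1,3))

lemma qcnj_of_real [simp]: "qcnj (of_real r) = of_real r"
  by (simp add: of_real_def qcnj_scaleR)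

lemma qcnj_sum: "qcnj (sum f A) = (\<Sum>x\<in>A. qcnj (f x))"
  by (induction A rule: infinite_finite_induct) (simp_all add: qcnj_add)

lemma bounded_linear_qcnj: "bounded_linear qcnj"
  by (rule bounded_linear_intro [where K = 1]) (simp_all add: qcnj_add qcnj_scaleR)

lemma inner_quat_eq: "inner x y = qRe (qcnj y * x)"
  by (simp add: inner_quat_def qcnj_def times_quat_def)

lemma of_real_commute: "of_real r * (x :: quat) = x * of_real r"
  by (simp add: of_real_def)

lemma real_if_qcnj_eq: "qcnj x = x \<Longrightarrow> \<exists>r. x = of_real r"
  by (rule exI [of _ "qRe x"])
    (auto simp: of_real_def quat_eq_iff qcnj_def quat_ring_defs scaleR_quat_def)

lemma quat_square: "a * a = of_real (2 * qRe a) * a - of_real ((norm a)\<^sup>2)"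
proof -
  have "of_real (2 * qRe a) * a - of_real ((norm a)\<^sup>2) = (a + qcnj a) * a - qcnj a * a"
    by (simp only: quat_add_qcnj quat_mult_qcnj)
  then show ?thesis by (simp add: algebra_simps)
qed

text \<open>Both quaternions satisfy the same real quadratic, whence \<open>b - qcnj a\<close>
  intertwines \<open>a\<close> and \<open>b\<close>. It vanishes only for \<open>b = qcnj a\<close>;
  there a nonzero imaginary quaternion orthogonal to the imaginary part of \<open>a\<close> serves,
  because it anticommutes with that part.\<close>

lemma sim_class_iff: "b \<in> sim_class a \<longleftrightarrow> qRe b = qRe a \<and> norm b = norm a"
proof
  assume eq: "qRe b = qRe a \<and> norm b = norm a"
  have "\<exists>h. h \<noteq> 0 \<and> h * a = b * h"
  proof (cases "b = qcnj a")
    case False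
    have "b * (b - qcnj a) = b * b - b * qcnj a"
      by (simp add: algebra_simps)
    also have "\<dots> = b * (a + qcnj a) - of_real ((norm a)\<^sup>2) - b * qcnj a"
      using quat_square [of b] eq of_real_commute [of "2 * qRe a" b]
      by (simp add: quat_add_qcnj del: of_real_mult of_real_power)
    also have "\<dots> = b * a - qcnj a * a"
      by (simp add: algebra_simps quat_mult_qcnj)
    finally have "(b - qcnj a) * a = b * (b - qcnj a)"
      by (simp add: algebra_simps)
    with False show ?thesis by (intro exI [of _ "b - qcnj a"]) simp
  next
    case True
    define h where
      "h = (if qIm1 a = 0 \<and> qIm2 a = 0 then Quat 0 1 0 0 else Quat 0 (qIm2 a) (- qIm1 a) 0)"
    have "h \<noteq> 0"
      by (simp add: h_def quat_eq_iff zero_quat_def)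
    moreover have "h * a = qcnj a * h"
      by (simp add: h_def times_quat_def qcnj_def)
    ultimately show ?thesis using True by blast
  qed
  then obtain h where h: "h \<noteq> 0" "h * a = b * h" by blast
  have "b = h * a * inverse h"
    using h by (simp add: mult.assoc)
  with h show "b \<in> sim_class a" unfolding sim_class_def by blast
qed (auto dest: sim_class_invariants)

lemma sim_class_eq: "b \<in> sim_class a \<Longrightarrow> sim_class b = sim_class a"
  by (auto simp: sim_class_iff)

lemma qcnj_in_sim_class: "b \<in> sim_class a \<Longrightarrow> qcnj b \<in> sim_class a"
  by (simp add: sim_class_iff)

lemma conjugate_in_sim_class: "w \<noteq> 0 \<Longrightarrow> inverse w * a * w \<in> sim_class a"
  unfolding sim_class_def by (force intro: exI [of _ "inverse w"])

lemma norm_conjugate: "w \<noteq> 0 \<Longrightarrow> norm (inverse w * a * w) = norm (a :: quat)"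
  using conjugate_in_sim_class sim_class_iff by blast

lemma conjugate_power:
  fixes a w :: quat
  assumes "w \<noteq> 0"
  shows "w * (inverse w * a * w) ^ k = a ^ k * w"
proof (induction k)
  case (Suc k)
  have "w * (inverse w * a * w) ^ Suc k = (w * inverse w) * a * (w * (inverse w * a * w) ^ k)"
    by (simp add: mult.assoc)
  then show ?case using assms Suc by (simp add: mult.assoc)
qed simp


section \<open>Power series of radius at least one\<close>

lemma H1_iff: "f \<in> H1 \<longleftrightarrow> fps_conv_radius f \<ge> 1"
proof -
  let ?L = "limsup (\<lambda>k. ereal (root k (norm (fps_nth f k))))"
  have "0 = limsup (\<lambda>k. 0 :: ereal)" by (simp add: Limsup_const)
  also have "\<dots> \<le> ?L" by (intro Limsup_mono) (simp add: real_root_ge_zero)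
  finally have "0 \<le> ?L" .
  then have "?L \<le> 1 \<longleftrightarrow> 1 \<le> inverse ?L"
    by (cases ?L) (auto simp: field_simps one_ereal_def divide_simps)
  then show ?thesis
    by (simp add: H1_def fps_conv_radius_def conv_radius_def)
qed

lemma H1_summable_norm:
  assumes "f \<in> H1" "0 \<le> r" "r < 1"
  shows "summable (\<lambda>k. norm (fps_nth f k) * r ^ k)"
proof -
  have "ereal (norm (of_real r :: quat)) < 1" using assms by simp
  also have "1 \<le> conv_radius (fps_nth f)" using assms by (simp add: H1_iff fps_conv_radius_def)
  finally have "summable (\<lambda>k. norm (fps_nth f k * of_real r ^ k))"
    by (rule abs_summable_in_conv_radius)
  then show ?thesis using assms by (simp add: norm_mult norm_power)
qed

lemma H1_summable: "f \<in> H1 \<Longrightarrow> norm c < 1 \<Longrightarrow> summable (\<lambda>k. c ^ k * fps_nth f k)"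
  by (rule summable_norm_cancel)
    (use H1_summable_norm [of f "norm c"] in \<open>simp add: norm_mult norm_power mult.commute\<close>)

lemma H1_bounded:
  assumes "f \<in> H1" "0 \<le> r" "r < 1"
  shows "\<exists>C\<ge>0. \<forall>k. norm (fps_nth f k) * r ^ k \<le> C"
proof -
  have "Bseq (\<lambda>k. norm (fps_nth f k) * r ^ k)"
    using H1_summable_norm [OF assms] summable_imp_Bseq by blast
  then obtain C where "C > 0" "\<forall>k. norm (norm (fps_nth f k) * r ^ k) \<le> C"
    by (auto simp: Bseq_def)
  then show ?thesis using assms by (intro exI [of _ C]) (auto simp: abs_le_iff)
qed

text \<open>Boundedness at a radius \<open>s\<close> gives summability at every smaller radius by
  comparison with a geometric series, so bounds at all radii below 1 suffice.\<close>

lemma H1_I: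
  assumes "\<And>r. 0 < r \<Longrightarrow> r < 1 \<Longrightarrow> \<exists>C. \<forall>k. norm (fps_nth f k) * r ^ k \<le> C"
  shows "f \<in> H1"
proof -
  have "conv_radius (fps_nth f) \<ge> 1"
  proof (rule conv_radius_geI_ex')
    fix r :: real
    assume r: "0 < r" "ereal r < 1"
    define s where "s = (1 + r) / 2"
    have s: "r < s" "0 < s" "s < 1" using r by (auto simp: s_def)
    from assms [of s] s obtain C where C: "\<And>k. norm (fps_nth f k) * s ^ k \<le> C" by auto
    have "summable (\<lambda>k. C * (r / s) ^ k)"
      using r s by (intro summable_mult summable_geometric) auto
    moreover have "norm (fps_nth f k * of_real r ^ k) \<le> C * (r / s) ^ k" for k
      using mult_right_mono [OF C [of k], of "(r / s) ^ k"] r s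
      by (simp add: norm_mult norm_power power_divide)
    ultimately show "summable (\<lambda>k. fps_nth f k * of_real r ^ k)"
      by (rule summable_comparison_test' [where N = 0])
  qed
  then show ?thesis by (simp add: H1_iff fps_conv_radius_def)
qed

lemma H1_bounded_coeffs:
  assumes "\<And>k. norm (fps_nth f k) \<le> C"
  shows "f \<in> H1"
proof (rule H1_I, intro exI allI)
  fix r :: real and k
  assume "0 < r" "r < 1"
  then have "norm (fps_nth f k) * r ^ k \<le> norm (fps_nth f k) * 1"
    by (intro mult_left_mono power_le_one) auto
  with assms [of k] show "norm (fps_nth f k) * r ^ k \<le> C" by simp
qed

lemma H1_closed [simp, intro]:
  "0 \<in> H1" "1 \<in> H1" "fps_const c \<in> H1" "fps_X \<in> H1"
  "f \<in> H1 \<Longrightarrow> g \<in> H1 \<Longrightarrow> f + g \<in> H1"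
  "f \<in> H1 \<Longrightarrow> g \<in> H1 \<Longrightarrow> f - g \<in> H1"
  "f \<in> H1 \<Longrightarrow> g \<in> H1 \<Longrightarrow> f * g \<in> H1"
  "f \<in> H1 \<Longrightarrow> f ^ n \<in> H1"
  using fps_conv_radius_add [of f g] fps_conv_radius_diff [of f g] fps_conv_radius_mult [of f g]
    fps_conv_radius_power [of f n]
  by (auto simp: H1_iff min_def split: if_splits)

lemma H1_geometric: "norm a \<le> 1 \<Longrightarrow> Abs_fps (\<lambda>k. a ^ k) \<in> H1"
  by (rule H1_bounded_coeffs [where C = 1]) (simp add: norm_power power_le_one)

section \<open>Coefficientwise conjugation as an anti-automorphism\<close>

lemma fps_nth_sharp [simp]: "fps_nth (fps_sharp f) k = qcnj (fps_nth f k)"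
  by (simp add: fps_sharp_def)

lemma fps_sharp_sharp [simp]: "fps_sharp (fps_sharp f) = f"
  by (rule fps_ext) simp

lemma fps_sharp_simps [simp]:
  "fps_sharp 0 = 0" "fps_sharp 1 = 1" "fps_sharp fps_X = fps_X"
  "fps_sharp (fps_const c) = fps_const (qcnj c)"
  by (rule fps_ext; simp add: fps_X_def)+

lemma fps_sharp_diff: "fps_sharp (f - g) = fps_sharp f - fps_sharp g"
  by (rule fps_ext) (simp add: qcnj_diff)

lemma fps_sharp_mult: "fps_sharp (f * g) = fps_sharp g * fps_sharp f"
proof (rule fps_ext)
  fix n
  show "fps_nth (fps_sharp (f * g)) n = fps_nth (fps_sharp g * fps_sharp f) n"
    by (simp add: fps_mult_nth qcnj_sum qcnj_mult)
      (rule sum.reindex_bij_witness [of _ "\<lambda>i. n - i" "\<lambda>i. n - i"]; auto)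
qed

lemma fps_sharp_power: "fps_sharp (f ^ n) = fps_sharp f ^ n"
  by (induction n) (simp_all add: fps_sharp_mult power_commutes)

lemma fps_sharp_eq_0_iff [simp]: "fps_sharp f = 0 \<longleftrightarrow> f = 0"
  by (metis fps_sharp_sharp fps_sharp_simps(1))

lemma H1_sharp [simp]: "fps_sharp f \<in> H1 \<longleftrightarrow> f \<in> H1"
  by (simp add: H1_def)


section \<open>Point evaluation\<close>

lemma eval_left_add:
  "f \<in> H1 \<Longrightarrow> g \<in> H1 \<Longrightarrow> norm c < 1 \<Longrightarrow> eval_left (f + g) c = eval_left f c + eval_left g c"
  by (simp add: eval_left_def distrib_left suminf_add H1_summable)

lemma eval_left_diff:
  "f \<in> H1 \<Longrightarrow> g \<in> H1 \<Longrightarrow> norm c < 1 \<Longrightarrow> eval_left (f - g) c = eval_left f c - eval_left g c"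
  by (simp add: eval_left_def right_diff_distrib suminf_diff H1_summable)

lemma eval_left_const [simp]: "eval_left (fps_const w) c = w"
proof -
  have "(\<lambda>k. c ^ k * fps_nth (fps_const w) k) sums (\<Sum>k\<in>{0}. c ^ k * fps_nth (fps_const w) k)"
    by (rule sums_finite) auto
  then show ?thesis by (simp add: eval_left_def sums_iff)
qed

lemma eval_left_0 [simp]: "eval_left 0 c = 0" and eval_left_1 [simp]: "eval_left 1 c = 1"
  using eval_left_const [of _ c] by (metis fps_const_0_eq_0, metis fps_const_1_eq_1)

lemma eval_left_const_mult:
  assumes "f \<in> H1" "norm c < 1"
  shows "eval_left (fps_const w * f) c = w * eval_left f (inverse w * c * w)"
proof (cases "w = 0")
  case False
  then have "summable (\<lambda>k. (inverse w * c * w) ^ k * fps_nth f k)"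
    using assms norm_conjugate by (intro H1_summable) auto
  then have "w * eval_left f (inverse w * c * w) =
      (\<Sum>k. w * ((inverse w * c * w) ^ k * fps_nth f k))"
    unfolding eval_left_def by (rule suminf_mult [symmetric])
  also have "\<dots> = eval_left (fps_const w * f) c"
    unfolding eval_left_def using conjugate_power [OF False]
    by (simp add: mult.assoc [symmetric])
  finally show ?thesis by simp
qed simp

lemma eval_left_linear_factor:
  assumes "q \<in> H1" "norm a < 1"
  shows "eval_left ((fps_X - fps_const a) * q) a = 0"
proof -
  have s: "summable (\<lambda>k. a ^ k * fps_nth q k)" using assms by (rule H1_summable)
  have "eval_left (fps_X * q) a = (\<Sum>k. a ^ Suc k * fps_nth (fps_X * q) (Suc k))"
    unfolding eval_left_def
    by (subst suminf_split_head [OF H1_summable]) (use assms in simp_all)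
  also have "\<dots> = a * eval_left q a"
    unfolding eval_left_def using suminf_mult [OF s, of a] by (simp add: mult.assoc)
  also have "\<dots> = eval_left (fps_const a * q) a"
    unfolding eval_left_def suminf_mult [OF s, symmetric]
    by (simp add: mult.assoc [symmetric] power_commutes)
  finally show ?thesis using assms
    by (simp add: left_diff_distrib eval_left_diff)
qed

text \<open>Division with remainder by a linear factor, which for a power series runs from high to
  low degree: the coefficients of \<open>q\<close> are the values at \<open>a\<close> of the shifted
  series, and these converge because \<open>norm a < 1\<close>.\<close>

lemma eval_left_remainder:
  assumes f: "f \<in> H1" and a: "norm a < 1"
  shows "\<exists>q\<in>H1. f = (fps_X - fps_const a) * q + fps_const (eval_left f a)"
proof -
  have s: "summable (\<lambda>j. a ^ j * fps_nth f (k + j))" for k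
  proof -
    have "fps_shift k f \<in> H1" using f by (simp add: H1_iff)
    from H1_summable [OF this a] show ?thesis by (simp add: add.commute)
  qed
  define q where "q = Abs_fps (\<lambda>k. \<Sum>j. a ^ j * fps_nth f (Suc k + j))"
  have rec: "(\<Sum>j. a ^ j * fps_nth f (k + j)) = fps_nth f k + a * fps_nth q k" for k
  proof -
    have "(\<Sum>j. a ^ j * fps_nth f (k + j)) =
        fps_nth f k + (\<Sum>j. a ^ Suc j * fps_nth f (k + Suc j))"
      by (subst suminf_split_head [OF s]) simp
    also have "(\<Sum>j. a ^ Suc j * fps_nth f (k + Suc j)) = a * fps_nth q k"
      using suminf_mult [OF s [of "Suc k"], of a] by (simp add: q_def mult.assoc)
    finally show ?thesis .
  qed
  have "f = (fps_X - fps_const a) * q + fps_const (eval_left f a)"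
  proof (rule fps_ext)
    fix k
    show "fps_nth f k = fps_nth ((fps_X - fps_const a) * q + fps_const (eval_left f a)) k"
      using rec [of k] by (cases k) (simp_all add: left_diff_distrib eval_left_def q_def)
  qed
  moreover have "q \<in> H1"
  proof (rule H1_I)
    fix r :: real
    assume r: "0 < r" "r < 1"
    \<comment> \<open>The radius has to exceed \<open>norm a\<close> as well, so that the tails
      defining \<open>q\<close> are dominated by a geometric series of ratio
      \<open>norm a / s\<close>.\<close>
    define s where "s = max r ((1 + norm a) / 2)"
    have sb: "r \<le> s" "norm a < s" "0 < s" "s < 1" using r a by (auto simp: s_def less_max_iff_disj)
    obtain C where C: "C \<ge> 0" "\<And>k. norm (fps_nth f k) * s ^ k \<le> C"
      using H1_bounded [OF f, of s] sb by auto
    have geo: "summable (\<lambda>j. C / s * (norm a / s) ^ j)"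
      using sb by (intro summable_mult summable_geometric) auto
    have "norm (fps_nth q k) * r ^ k \<le> (\<Sum>j. C / s * (norm a / s) ^ j)" for k
    proof -
      have "norm (fps_nth q k) * r ^ k \<le> norm (fps_nth q k) * s ^ k"
        using sb r by (intro mult_left_mono power_mono) auto
      also have "\<dots> = norm (of_real (s ^ k) * fps_nth q k)"
        using sb by (simp add: norm_mult norm_power)
      also have "of_real (s ^ k) * fps_nth q k =
          (\<Sum>j. of_real (s ^ k) * (a ^ j * fps_nth f (Suc k + j)))"
        using suminf_mult [OF s [of "Suc k"]] by (simp add: q_def)
      also have "norm \<dots> \<le> (\<Sum>j. C / s * (norm a / s) ^ j)"
      proof (rule norm_suminf_le [OF _ geo])
        fix j
        have "norm (of_real (s ^ k) * (a ^ j * fps_nth f (Suc k + j))) =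
            (norm a / s) ^ j / s * (norm (fps_nth f (Suc k + j)) * s ^ (Suc k + j))"
          using sb by (simp add: norm_mult norm_power power_divide power_add)
        also have "\<dots> \<le> (norm a / s) ^ j / s * C"
          using sb by (intro mult_left_mono C) auto
        finally show "norm (of_real (s ^ k) * (a ^ j * fps_nth f (Suc k + j))) \<le>
            C / s * (norm a / s) ^ j" by (simp add: mult.commute)
      qed
      finally show ?thesis .
    qed
    then show "\<exists>C. \<forall>k. norm (fps_nth q k) * r ^ k \<le> C" by blast
  qed
  ultimately show ?thesis by blast
qed

lemma eval_left_eq_0_iff:
  assumes "f \<in> H1" "norm a < 1"
  shows "eval_left f a = 0 \<longleftrightarrow> (\<exists>q\<in>H1. f = (fps_X - fps_const a) * q)"
  using eval_left_remainder [OF assms] eval_left_linear_factor [OF _ assms(2)] by force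

text \<open>Modulo right multiples of \<open>fps_X - fps_const c\<close>, the factor
  \<open>f\<close> is the constant \<open>eval_left f c\<close>. Moving this constant past the
  powers of \<open>c\<close> conjugates the point at which \<open>g\<close> is evaluated. If the
  value is 0, the point is meaningless (\<open>inverse 0 = 0\<close>) but both sides are 0.\<close>

lemma eval_left_mult:
  assumes "f \<in> H1" "g \<in> H1" "norm c < 1"
  shows "eval_left (f * g) c = eval_left f c * eval_left g (inverse (eval_left f c) * c * eval_left f c)"
proof -
  define w where "w = eval_left f c"
  obtain q where q: "q \<in> H1" "f = (fps_X - fps_const c) * q + fps_const w"
    using eval_left_remainder [OF assms(1,3)] w_def by blast
  have "f * g = (fps_X - fps_const c) * (q * g) + fps_const w * g"
    by (simp add: q(2) distrib_right mult.assoc)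
  then have "eval_left (f * g) c = eval_left (fps_const w * g) c"
    using q assms by (simp add: eval_left_add eval_left_linear_factor)
  then show ?thesis using assms by (simp add: eval_left_const_mult w_def)
qed

lemma eval_right_sharp:
  assumes "f \<in> H1" "norm c < 1"
  shows "eval_right f c = qcnj (eval_left (fps_sharp f) (qcnj c))"
proof -
  have "summable (\<lambda>k. qcnj c ^ k * qcnj (fps_nth f k))"
    using H1_summable [of "fps_sharp f" "qcnj c"] assms by simp
  from bounded_linear.suminf [OF bounded_linear_qcnj this] show ?thesis
    by (simp add: eval_right_def eval_left_def qcnj_mult qcnj_power)
qed

lemma has_zero_at_iff:
  assumes "f \<in> H1"
  shows "has_zero_at f c \<longleftrightarrow>
    norm c < 1 \<and> (eval_left f c = 0 \<or> eval_left (fps_sharp f) (qcnj c) = 0)"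
  using assms by (auto simp: has_zero_at_def eval_right_sharp)


section \<open>Contractive multipliers\<close>

text \<open>The squared norm is truncated because coefficient \<open>n\<close> of a product depends
  only on the coefficients up to \<open>n\<close> of its factors. Contractivity can thus be tested
  on arbitrary formal series, with no convergence condition.\<close>

definition energy :: "nat \<Rightarrow> quat fps \<Rightarrow> real"
  where "energy n f = (\<Sum>k\<le>n. (norm (fps_nth f k))\<^sup>2)"

definition left_contractive :: "quat fps \<Rightarrow> bool"
  where "left_contractive f \<longleftrightarrow> (\<forall>g n. energy n (f * g) \<le> energy n g)"

definition right_contractive :: "quat fps \<Rightarrow> bool"
  where "right_contractive f \<longleftrightarrow> (\<forall>g n. energy n (g * f) \<le> energy n g)"

lemma energy_nonneg [simp]: "energy n f \<ge> 0"
  by (simp add: energy_def sum_nonneg)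

lemma energy_mono: "m \<le> n \<Longrightarrow> energy m f \<le> energy n f"
  unfolding energy_def by (rule sum_mono2) auto

lemma norm_le_energy: "(norm (fps_nth f n))\<^sup>2 \<le> energy n f"
  unfolding energy_def by (rule member_le_sum) auto

lemma energy_cong: "(\<And>k. k \<le> n \<Longrightarrow> fps_nth f k = fps_nth g k) \<Longrightarrow> energy n f = energy n g"
  by (simp add: energy_def)

lemma energy_sharp [simp]: "energy n (fps_sharp f) = energy n f"
  by (simp add: energy_def)

lemma energy_1 [simp]: "energy n 1 = 1"
  by (simp add: energy_def if_distrib [where f = norm] if_distrib [where f = "\<lambda>x. x\<^sup>2"] sum.delta
      cong: if_cong)

lemma left_contractive_sharp: "left_contractive (fps_sharp f) \<longleftrightarrow> right_contractive f"
proof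
  assume L: "left_contractive (fps_sharp f)"
  show "right_contractive f"
    unfolding right_contractive_def
  proof (intro allI)
    fix g n
    have "energy n (g * f) = energy n (fps_sharp f * fps_sharp g)"
      by (metis energy_sharp fps_sharp_mult)
    also have "\<dots> \<le> energy n g"
      using L by (metis energy_sharp left_contractive_def)
    finally show "energy n (g * f) \<le> energy n g" .
  qed
next
  assume R: "right_contractive f"
  show "left_contractive (fps_sharp f)"
    unfolding left_contractive_def
  proof (intro allI)
    fix g n
    have "energy n (fps_sharp f * g) = energy n (fps_sharp g * f)"
      by (metis energy_sharp fps_sharp_mult fps_sharp_sharp)
    also have "\<dots> \<le> energy n g"
      using R by (metis energy_sharp right_contractive_def)
    finally show "energy n (fps_sharp f * g) \<le> energy n g" .
  qed
qed

lemma norm_mult_coeff_le: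
  "norm (fps_nth (x * y) n) \<le> sqrt (energy n x) * sqrt (energy n y)"
proof -
  have "norm (fps_nth (x * y) n) \<le> (\<Sum>i\<le>n. \<bar>norm (fps_nth x i)\<bar> * \<bar>norm (fps_nth y (n - i))\<bar>)"
    unfolding fps_mult_nth atLeast0AtMost
    by (rule order_trans [OF norm_sum]) (simp add: norm_mult)
  also have "\<dots> \<le> L2_set (\<lambda>i. norm (fps_nth x i)) {..n} * L2_set (\<lambda>i. norm (fps_nth y (n - i))) {..n}"
    by (rule L2_set_mult_ineq)
  also have "L2_set (\<lambda>i. norm (fps_nth y (n - i))) {..n} = sqrt (energy n y)"
    unfolding L2_set_def energy_def
    by (rule arg_cong [of _ _ sqrt], rule sum.reindex_bij_witness [of _ "\<lambda>i. n - i" "\<lambda>i. n - i"]) auto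
  finally show ?thesis by (simp add: L2_set_def energy_def)
qed

text \<open>The truncated multiplication operators from the left and from the right are adjoint to each
  other, up to reversing the order of the coefficients.\<close>

lemma right_imp_left_contractive:
  assumes "right_contractive f"
  shows "left_contractive f"
  unfolding left_contractive_def
proof (intro allI)
  fix g n
  define y where "y = f * g"
  define z where "z = Abs_fps (\<lambda>k. qcnj (fps_nth y (n - k)))"
  have z: "energy n z = energy n y"
    unfolding energy_def z_def
    by (rule sum.reindex_bij_witness [of _ "\<lambda>i. n - i" "\<lambda>i. n - i"]) auto
  have "fps_nth (z * y) n = of_real (\<Sum>i\<le>n. (norm (fps_nth y (n - i)))\<^sup>2)"
    by (simp add: fps_mult_nth atLeast0AtMost z_def quat_mult_qcnj del: of_real_power)
  also have "(\<Sum>i\<le>n. (norm (fps_nth y (n - i)))\<^sup>2) = energy n y"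
    unfolding energy_def
    by (rule sum.reindex_bij_witness [of _ "\<lambda>i. n - i" "\<lambda>i. n - i"]) auto
  finally have "energy n y = norm (fps_nth (z * y) n)" by simp
  also have "z * y = (z * f) * g" by (simp add: y_def mult.assoc)
  also have "norm (fps_nth \<dots> n) \<le> sqrt (energy n (z * f)) * sqrt (energy n g)"
    by (rule norm_mult_coeff_le)
  also have "\<dots> \<le> sqrt (energy n z) * sqrt (energy n g)"
    using assms by (intro mult_right_mono) (auto simp: right_contractive_def)
  finally have "sqrt (energy n y) * sqrt (energy n y) \<le> sqrt (energy n g) * sqrt (energy n y)"
    by (simp add: z mult.commute)
  then have "sqrt (energy n y) \<le> sqrt (energy n g) \<or> \<not> sqrt (energy n y) > 0"
    by (meson mult_right_le_imp_le)
  moreover have "sqrt (energy n y) \<ge> 0" "sqrt (energy n g) \<ge> 0" by simp_all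
  ultimately have "sqrt (energy n y) \<le> sqrt (energy n g)" by linarith
  then show "energy n (f * g) \<le> energy n g" by (simp add: y_def)
qed


section \<open>A discrete Parseval identity\<close>

text \<open>Embeds the complex numbers as the slice spanned by 1 and the first imaginary unit. It
  supplies roots of unity that commute with each other, which is all that the averaging argument
  needs.\<close>

definition quat_of_complex :: "complex \<Rightarrow> quat"
  where "quat_of_complex z = Quat (Re z) (Im z) 0 0"

lemma quat_of_complex_simps:
  "quat_of_complex 0 = 0" "quat_of_complex 1 = 1" "quat_of_complex (of_nat n) = of_nat n"
  "quat_of_complex (x + y) = quat_of_complex x + quat_of_complex y"
  "quat_of_complex (x * y) = quat_of_complex x * quat_of_complex y"
  "qcnj (quat_of_complex x) = quat_of_complex (cnj x)"
  "norm (quat_of_complex x) = norm x"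
proof -
  show add: "quat_of_complex (x + y) = quat_of_complex x + quat_of_complex y" for x y
    by (simp add: quat_of_complex_def quat_ring_defs)
  show "quat_of_complex 0 = 0" "quat_of_complex 1 = 1"
    by (simp_all add: quat_of_complex_def quat_ring_defs)
  then show "quat_of_complex (of_nat n) = of_nat n"
    by (induction n) (simp_all add: add)
qed (simp_all add: quat_of_complex_def quat_ring_defs qcnj_def norm_quat_def cmod_def)

lemma quat_of_complex_sum: "quat_of_complex (sum f A) = (\<Sum>x\<in>A. quat_of_complex (f x))"
  by (induction A rule: infinite_finite_induct) (simp_all add: quat_of_complex_simps)

lemma quat_of_complex_power: "quat_of_complex (x ^ n) = quat_of_complex x ^ n"
  by (induction n) (simp_all add: quat_of_complex_simps)

lemma sum_powers_root_of_unity: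
  assumes "k < N" "l < N"
  shows "(\<Sum>j<N. (cnj (cis (2 * pi / N)) ^ l * cis (2 * pi / N) ^ k) ^ j) =
    (if k = l then of_nat N else 0)"
proof -
  define z where "z = cis (2 * pi / N)"
  have pow: "z ^ m = cis (2 * pi * real m / real N)" for m
    using Complex.DeMoivre [of "2 * pi / N" m] by (simp add: z_def mult.commute mult.left_commute)
  have N: "N > 0" using assms by simp
  have zN: "z ^ N = 1" using N by (simp add: pow)
  have "z \<noteq> 0" by (simp add: z_def)
  have cnj: "cnj z ^ l = inverse (z ^ l)"
    by (simp add: z_def cis_cnj power_inverse flip: cis_inverse)
  show ?thesis
  proof (cases "k = l")
    case True
    with \<open>z \<noteq> 0\<close> show ?thesis unfolding z_def [symmetric] cnj by simp
  next
    case False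
    have "inj_on (\<lambda>k. cis (2 * pi * real k / real N)) {..<N}"
      using Complex.bij_betw_roots_unity [OF N] by (rule bij_betw_imp_inj_on)
    with False assms have "z ^ k \<noteq> z ^ l"
      unfolding pow by (auto dest: inj_onD)
    with \<open>z \<noteq> 0\<close> have 1: "cnj z ^ l * z ^ k \<noteq> 1"
      by (simp add: cnj field_simps)
    have 2: "(cnj z ^ l * z ^ k) ^ N = 1"
      by (simp add: power_mult_distrib cnj power_inverse zN flip: power_mult)
        (simp add: power_mult mult.commute zN)
    show ?thesis
      unfolding z_def [symmetric] using False 1 2 by (simp add: geometric_sum)
  qed
qed

text \<open>In \<open>inner x y = qRe (qcnj y * x)\<close> the powers of \<open>w\<close> standing
  left of the coefficients meet in the middle, where they commute. Orthogonality of roots of unity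
  therefore applies although the coefficients do not commute with \<open>w\<close>.\<close>

lemma discrete_parseval:
  assumes "w = quat_of_complex (cis (2 * pi / N))"
  shows "(\<Sum>j<N. (norm (\<Sum>k<N. (w ^ j) ^ k * c k))\<^sup>2) = real N * (\<Sum>k<N. (norm (c k))\<^sup>2)"
proof -
  define z where "z = cis (2 * pi / N)"
  have inner: "inner ((w ^ j) ^ k * c k) ((w ^ j) ^ l * c l) =
      inner (quat_of_complex ((cnj z ^ l * z ^ k) ^ j) * c k) (c l)" for j k l
  proof -
    have "quat_of_complex ((cnj z ^ l * z ^ k) ^ j) = qcnj ((w ^ j) ^ l) * (w ^ j) ^ k"
      unfolding assms z_def [symmetric]
      by (simp add: quat_of_complex_simps power_mult_distrib
          flip: quat_of_complex_power power_mult) (simp add: mult.commute)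
    then show ?thesis
      by (simp add: inner_quat_eq qcnj_mult mult.assoc)
  qed
  have "(\<Sum>j<N. (norm (\<Sum>k<N. (w ^ j) ^ k * c k))\<^sup>2) =
      (\<Sum>j<N. \<Sum>k<N. \<Sum>l<N. inner (quat_of_complex ((cnj z ^ l * z ^ k) ^ j) * c k) (c l))"
    unfolding power2_norm_eq_inner inner_sum_left inner_sum_right inner
    by (intro sum.cong refl sum.swap)
  also have "\<dots> = (\<Sum>k<N. \<Sum>l<N. \<Sum>j<N. inner (quat_of_complex ((cnj z ^ l * z ^ k) ^ j) * c k) (c l))"
    by (subst sum.swap) (intro sum.cong refl sum.swap)
  also have "\<dots> = (\<Sum>k<N. \<Sum>l<N.
      inner (quat_of_complex (\<Sum>j<N. (cnj z ^ l * z ^ k) ^ j) * c k) (c l))"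
    by (simp add: quat_of_complex_sum sum_distrib_right inner_sum_left)
  also have "\<dots> = (\<Sum>k<N. \<Sum>l<N. if k = l then real N * (norm (c k))\<^sup>2 else 0)"
  proof (intro sum.cong refl)
    fix k l
    assume "k \<in> {..<N}" "l \<in> {..<N}"
    then show "inner (quat_of_complex (\<Sum>j<N. (cnj z ^ l * z ^ k) ^ j) * c k) (c l) =
        (if k = l then real N * (norm (c k))\<^sup>2 else 0)"
      using sum_powers_root_of_unity [of k N l] scaleR_conv_of_real [of "real N" "c k", symmetric]
      by (auto simp: z_def quat_of_complex_simps power2_norm_eq_inner)
  qed
  also have "\<dots> = real N * (\<Sum>k<N. (norm (c k))\<^sup>2)"
    by (simp add: sum.delta sum_distrib_left)
  finally show ?thesis .
qed


section \<open>The Schur class\<close>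

text \<open>By \<open>eval_left_mult\<close> the left value of \<open>g * f\<close> is that of
  \<open>g\<close> times a left value of \<open>f\<close> at a conjugated point, hence no larger
  than that of \<open>g\<close>; this is why left values control multiplication from the right.
  Averaging over \<open>M\<close> equidistant points of radius \<open>r\<close> in one complex slice
  turns the comparison of values into one of coefficients. Then \<open>M\<close> tends to infinity
  and \<open>r\<close> to 1.\<close>

lemma schur_imp_right_contractive:
  assumes "f \<in> schur_class"
  shows "right_contractive f"
  unfolding right_contractive_def
proof (intro allI)
  fix g0 :: "quat fps" and n
  \<comment> \<open>Coefficients beyond \<open>n\<close> do not affect the claim. A polynomial lies
    in \<open>H1\<close>, and with more than \<open>n\<close> sample points its values obey the
    Parseval identity without error.\<close>
  define g where "g = fps_cutoff (Suc n) g0"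
  define F where "F = g * f"
  have nth_g: "fps_nth g k = (if k \<le> n then fps_nth g0 k else 0)" for k
    by (simp add: g_def less_Suc_eq_le)
  have f: "f \<in> H1" "\<And>c. norm c < 1 \<Longrightarrow> norm (eval_left f c) \<le> 1"
    using assms by (auto simp: schur_class_def)
  have g: "g \<in> H1"
  proof (rule H1_bounded_coeffs)
    show "norm (fps_nth g k) \<le> (\<Sum>k\<le>n. norm (fps_nth g0 k))" for k
      by (auto simp: nth_g sum_nonneg intro: member_le_sum)
  qed
  have F: "F \<in> H1" using f g by (simp add: F_def)
  have eval_F: "norm (eval_left F c) \<le> norm (eval_left g c)" if "norm c < 1" for c
  proof (cases "eval_left g c = 0")
    case False
    then have "norm (eval_left f (inverse (eval_left g c) * c * eval_left g c)) \<le> 1"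
      using that norm_conjugate by (intro f) auto
    then show ?thesis
      using that f g unfolding F_def by (simp add: eval_left_mult norm_mult mult_left_le)
  qed (use that f g in \<open>simp add: F_def eval_left_mult\<close>)
  have main: "(\<Sum>k\<le>n. (r ^ k * norm (fps_nth F k))\<^sup>2) \<le> energy n g" if r: "0 < r" "r < 1" for r
  proof -
    \<comment> \<open>\<open>M\<close> sample points resolve exactly \<open>M\<close> coefficients,
      so \<open>F\<close> is cut off at \<open>M\<close>; \<open>t M\<close> bounds the discarded
      part on the circle of radius \<open>r\<close>. As \<open>C\<close> bounds the values of
      \<open>g\<close> there, squaring the estimate adds at most
      \<open>2 * C * t M + (t M)\<^sup>2\<close>.\<close>
    define C where "C = (\<Sum>k\<le>n. norm (fps_nth g k))"
    define t where "t = (\<lambda>M. \<Sum>k. norm (fps_nth F (k + M)) * r ^ (k + M))"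
    have sumF: "summable (\<lambda>k. norm (fps_nth F k) * r ^ k)"
      using H1_summable_norm [OF F] r by simp
    have t0: "t \<longlonglongrightarrow> 0"
    proof (rule LIMSEQ_I)
      fix e :: real
      assume "0 < e"
      from suminf_exist_split [OF this sumF] show "\<exists>no. \<forall>M\<ge>no. norm (t M - 0) < e"
        by (simp add: t_def)
    qed
    have "(\<Sum>k\<le>n. (r ^ k * norm (fps_nth F k))\<^sup>2) \<le> energy n g + (2 * C * t M + (t M)\<^sup>2)"
      if M: "n < M" for M
    proof -
      define w where "w = quat_of_complex (cis (2 * pi / M))"
      define c where "c = (\<lambda>j. r *\<^sub>R w ^ j)"
      have "norm w = 1" by (simp add: w_def quat_of_complex_simps)
      then have c: "norm (c j) = r" for j using r by (simp add: c_def norm_power)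
      have parseval: "(\<Sum>j<M. (norm (\<Sum>k<M. c j ^ k * fps_nth h k))\<^sup>2) =
          M * (\<Sum>k<M. (r ^ k * norm (fps_nth h k))\<^sup>2)" for h
        using discrete_parseval [OF w_def, of "\<lambda>k. (r ^ k) *\<^sub>R fps_nth h k"] r
        by (simp add: c_def scaleR_power)
      have eval_g: "eval_left g (c j) = (\<Sum>k<M. c j ^ k * fps_nth g k)" for j
        unfolding eval_left_def using M by (intro suminf_finite) (auto simp: nth_g)
      have "norm (eval_left g (c j)) \<le> C" for j
      proof -
        have "eval_left g (c j) = (\<Sum>k\<le>n. c j ^ k * fps_nth g k)"
          unfolding eval_left_def by (intro suminf_finite) (auto simp: nth_g)
        also have "norm \<dots> \<le> (\<Sum>k\<le>n. norm (fps_nth g k))"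
          using r by (intro sum_norm_le)
            (auto simp: norm_mult norm_power c intro!: mult_left_le_one_le power_le_one)
        finally show ?thesis by (simp add: C_def)
      qed
      note eval_g_le = this
      have tail: "norm (\<Sum>k<M. c j ^ k * fps_nth F k) \<le> norm (eval_left g (c j)) + t M" for j
      proof -
        have "norm (c j) < 1" using c r by simp
        note s = H1_summable [OF F this]
        have "eval_left F (c j) - (\<Sum>k<M. c j ^ k * fps_nth F k) =
            (\<Sum>k. c j ^ (k + M) * fps_nth F (k + M))"
          unfolding eval_left_def by (simp only: suminf_minus_initial_segment [OF s])
        also have "norm \<dots> \<le> t M"
          unfolding t_def
          by (rule norm_suminf_le)
            (use sumF summable_ignore_initial_segment [OF sumF, of M] in
              \<open>simp_all add: norm_mult norm_power c mult.commute\<close>)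
        finally have "norm (eval_left F (c j) - (\<Sum>k<M. c j ^ k * fps_nth F k)) \<le> t M" .
        moreover have "norm (eval_left F (c j)) \<le> norm (eval_left g (c j))"
          using c r by (intro eval_F) simp
        ultimately show ?thesis
          using norm_triangle_ineq2 [of "\<Sum>k<M. c j ^ k * fps_nth F k" "eval_left F (c j)"]
          by (simp add: norm_minus_commute)
      qed
      have t_nonneg: "t M \<ge> 0"
        unfolding t_def using r summable_ignore_initial_segment [OF sumF, of M]
        by (intro suminf_nonneg) auto
      have "M * (\<Sum>k<M. (r ^ k * norm (fps_nth F k))\<^sup>2) \<le>
          (\<Sum>j<M. (norm (eval_left g (c j)))\<^sup>2 + (2 * C * t M + (t M)\<^sup>2))"
        unfolding parseval [symmetric]
      proof (rule sum_mono)
        fix j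
        have "(norm (\<Sum>k<M. c j ^ k * fps_nth F k))\<^sup>2 \<le> (norm (eval_left g (c j)) + t M)\<^sup>2"
          by (intro power_mono tail) auto
        also have "\<dots> = (norm (eval_left g (c j)))\<^sup>2 + (2 * norm (eval_left g (c j)) * t M + (t M)\<^sup>2)"
          by (simp add: power2_eq_square algebra_simps)
        also have "\<dots> \<le> (norm (eval_left g (c j)))\<^sup>2 + (2 * C * t M + (t M)\<^sup>2)"
          using mult_right_mono [OF eval_g_le [of j] t_nonneg] by simp
        finally show "(norm (\<Sum>k<M. c j ^ k * fps_nth F k))\<^sup>2 \<le>
            (norm (eval_left g (c j)))\<^sup>2 + (2 * C * t M + (t M)\<^sup>2)" .
      qed
      also have "\<dots> = M * ((\<Sum>k<M. (r ^ k * norm (fps_nth g k))\<^sup>2) + (2 * C * t M + (t M)\<^sup>2))"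
        unfolding sum.distrib eval_g parseval by (simp add: distrib_left)
      finally have "(\<Sum>k<M. (r ^ k * norm (fps_nth F k))\<^sup>2) \<le>
          (\<Sum>k<M. (r ^ k * norm (fps_nth g k))\<^sup>2) + (2 * C * t M + (t M)\<^sup>2)"
        using M by (simp only: mult_le_cancel_left_pos of_nat_0_less_iff)
      moreover have "(\<Sum>k\<le>n. (r ^ k * norm (fps_nth F k))\<^sup>2) \<le>
          (\<Sum>k<M. (r ^ k * norm (fps_nth F k))\<^sup>2)"
        using M by (intro sum_mono2) auto
      moreover have "(\<Sum>k<M. (r ^ k * norm (fps_nth g k))\<^sup>2) = (\<Sum>k\<le>n. (r ^ k * norm (fps_nth g k))\<^sup>2)"
        using M by (intro sum.mono_neutral_right) (auto simp: nth_g)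
      moreover have "(\<Sum>k\<le>n. (r ^ k * norm (fps_nth g k))\<^sup>2) \<le> energy n g"
        unfolding energy_def using r
        by (intro sum_mono power_mono mult_left_le_one_le power_le_one) auto
      ultimately show ?thesis by linarith
    qed
    then have "\<forall>\<^sub>F M in sequentially.
        (\<Sum>k\<le>n. (r ^ k * norm (fps_nth F k))\<^sup>2) \<le> energy n g + (2 * C * t M + (t M)\<^sup>2)"
      by (intro eventually_mono [OF eventually_gt_at_top [of n]])
    moreover have "(\<lambda>M. energy n g + (2 * C * t M + (t M)\<^sup>2)) \<longlonglongrightarrow> energy n g + (2 * C * 0 + 0\<^sup>2)"
      by (intro tendsto_intros t0)
    ultimately show ?thesis
      using tendsto_lowerbound by fastforce
  qed
  have "((\<lambda>r. \<Sum>k\<le>n. (r ^ k * norm (fps_nth F k))\<^sup>2) \<longlongrightarrow> (\<Sum>k\<le>n. (1 ^ k * norm (fps_nth F k))\<^sup>2))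
      (at_left (1 :: real))"
    by (intro tendsto_intros)
  moreover have "\<forall>\<^sub>F r in at_left (1 :: real). (\<Sum>k\<le>n. (r ^ k * norm (fps_nth F k))\<^sup>2) \<le> energy n g"
    using eventually_at_left_real [of 0 1] by (rule eventually_mono) (auto intro: main)
  ultimately have "(\<Sum>k\<le>n. (1 ^ k * norm (fps_nth F k))\<^sup>2) \<le> energy n g"
    by (rule tendsto_upperbound) simp
  then have "energy n F \<le> energy n g"
    by (simp add: energy_def)
  moreover have "energy n F = energy n (g0 * f)"
    unfolding F_def by (rule energy_cong) (auto simp: fps_mult_nth nth_g intro!: sum.cong)
  moreover have "energy n g = energy n g0"
    by (rule energy_cong) (simp add: nth_g)
  ultimately show "energy n (g0 * f) \<le> energy n g0" by simp
qed

lemma left_contractive_coeff_le: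
  assumes "left_contractive f"
  shows "norm (fps_nth f n) \<le> 1"
proof -
  have "energy n (f * 1) \<le> energy n 1"
    using assms left_contractive_def by blast
  then have "(norm (fps_nth f n))\<^sup>2 \<le> 1"
    using norm_le_energy [of f n] by simp
  then show ?thesis by (simp add: abs_square_le_1)
qed

text \<open>Test the contraction on the series with coefficients \<open>qcnj d ^ k\<close>, whose left value at
  \<open>d\<close> is maximal among all series of the same norm.\<close>

lemma left_contractive_imp_schur:
  assumes "left_contractive f"
  shows "f \<in> schur_class"
proof -
  have f: "f \<in> H1"
    by (rule H1_bounded_coeffs [OF left_contractive_coeff_le [OF assms]])
  have "norm (eval_left f c) \<le> 1" if c: "norm c < 1" for c
  proof (cases "eval_left f c = 0")
    case False
    define w where "w = eval_left f c"
    define d where "d = inverse w * c * w"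
    define g where "g = Abs_fps (\<lambda>k. qcnj d ^ k)"
    define s where "s = 1 / (1 - (norm c)\<^sup>2)"
    have d: "norm d = norm c"
      using False by (simp add: d_def w_def norm_conjugate)
    have g: "g \<in> H1"
      unfolding g_def by (rule H1_geometric) (use c d in simp)
    have c2: "(norm c)\<^sup>2 < 1" using c by (simp add: abs_square_less_1)
    have geo: "(\<lambda>k. ((norm c)\<^sup>2) ^ k) sums s"
      unfolding s_def by (rule geometric_sums) (use c2 in simp)
    have part: "(\<Sum>k\<le>n. ((norm c)\<^sup>2) ^ k) \<le> s" for n
      using geo sum_le_suminf [of "\<lambda>k. ((norm c)\<^sup>2) ^ k" "{..n}"] by (simp add: sums_iff)
    have "s > 0" using c2 by (simp add: s_def)
    have "d ^ k * qcnj d ^ k = of_real (((norm c)\<^sup>2) ^ k)" for k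
    proof -
      have "d ^ k * qcnj d ^ k = of_real ((norm (d ^ k))\<^sup>2)"
        using quat_mult_qcnj(1) [of "d ^ k"] by (simp add: qcnj_power)
      then show ?thesis by (simp add: norm_power d power_mult [symmetric] mult.commute)
    qed
    then have "eval_left g d = (\<Sum>k. of_real (((norm c)\<^sup>2) ^ k))"
      by (simp add: eval_left_def g_def)
    also have "\<dots> = of_real s"
      using geo by (metis sums_iff sums_of_real)
    finally have "eval_left (f * g) c = w * of_real s"
      using eval_left_mult [OF f g c] by (simp add: w_def d_def)
    moreover have "(\<lambda>n. \<Sum>k\<le>n. c ^ k * fps_nth (f * g) k) \<longlonglongrightarrow> eval_left (f * g) c"
      unfolding eval_left_def using H1_summable [of "f * g" c] f g c
      by (intro summable_LIMSEQ') auto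
    moreover have "norm (\<Sum>k\<le>n. c ^ k * fps_nth (f * g) k) \<le> s" for n
    proof -
      have "norm (\<Sum>k\<le>n. c ^ k * fps_nth (f * g) k) \<le>
          (\<Sum>k\<le>n. \<bar>norm c ^ k\<bar> * \<bar>norm (fps_nth (f * g) k)\<bar>)"
        by (rule order_trans [OF norm_sum]) (simp add: norm_mult norm_power)
      also have "\<dots> \<le> L2_set (\<lambda>k. norm c ^ k) {..n} * L2_set (\<lambda>k. norm (fps_nth (f * g) k)) {..n}"
        by (rule L2_set_mult_ineq)
      also have "\<dots> \<le> sqrt s * sqrt s"
      proof (rule mult_mono)
        show "L2_set (\<lambda>k. norm c ^ k) {..n} \<le> sqrt s"
          unfolding L2_set_def using part [of n]
          by (simp add: power_mult [symmetric] mult.commute)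
        have "energy n (f * g) \<le> energy n g"
          using assms left_contractive_def by blast
        also have "energy n g = (\<Sum>k\<le>n. ((norm c)\<^sup>2) ^ k)"
          by (simp add: energy_def g_def norm_power d power_mult [symmetric] mult.commute)
        also have "\<dots> \<le> s" by (rule part)
        finally show "L2_set (\<lambda>k. norm (fps_nth (f * g) k)) {..n} \<le> sqrt s"
          by (simp add: L2_set_def energy_def)
      qed (use \<open>s > 0\<close> in \<open>simp_all add: L2_set_nonneg\<close>)
      finally show ?thesis using \<open>s > 0\<close> by simp
    qed
    ultimately have "norm (w * of_real s) \<le> s"
      by (intro LIMSEQ_le_const2 [OF tendsto_norm]) auto
    then show ?thesis using \<open>s > 0\<close> by (simp add: norm_mult w_def)
  qed simp
  with f show ?thesis by (simp add: schur_class_def)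
qed

lemma schur_iff_left_contractive: "f \<in> schur_class \<longleftrightarrow> left_contractive f"
  using schur_imp_right_contractive right_imp_left_contractive left_contractive_imp_schur by blast

text \<open>The left bound implies right contractivity of \<open>f\<close>, which is left
  contractivity of \<open>fps_sharp f\<close>, which is again the left bound. In view of
  \<open>eval_right_sharp\<close> this contains the equivalence of the pointwise bounds on left and
  on right values.\<close>

lemma schur_sharp [simp]: "fps_sharp f \<in> schur_class \<longleftrightarrow> f \<in> schur_class"
  by (metis fps_sharp_sharp left_contractive_sharp right_imp_left_contractive
      schur_iff_left_contractive schur_imp_right_contractive)

lemma schur_imp_H1: "f \<in> schur_class \<Longrightarrow> f \<in> H1"
  by (simp add: schur_class_def)

lemma schur_mult: "f \<in> schur_class \<Longrightarrow> g \<in> schur_class \<Longrightarrow> f * g \<in> schur_class"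
  unfolding schur_iff_left_contractive left_contractive_def
  by (metis mult.assoc order_trans)

lemma schur_const: "norm u \<le> 1 \<Longrightarrow> fps_const u \<in> schur_class"
  by (simp add: schur_class_def)


section \<open>Blaschke factors\<close>

text \<open>The hypothesis says that all coefficients are real. In this form, centrality of class
  polynomials, conjugate Blaschke pairs and norm series follows from the rules for
  \<open>fps_sharp\<close> alone.\<close>

lemma fps_sharp_eq_imp_central:
  assumes "fps_sharp r = r"
  shows "r * g = g * r"
proof (rule fps_ext)
  have "fps_nth r i * x = x * fps_nth r i" for i x
    using assms real_if_qcnj_eq by (metis fps_nth_sharp of_real_commute)
  then show "fps_nth (r * g) n = fps_nth (g * r) n" for n
    by (simp add: fps_mult_nth)
      (rule sum.reindex_bij_witness [of _ "\<lambda>i. n - i" "\<lambda>i. n - i"]; auto)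
qed

lemma fps_sharp_mult_self:
  "fps_sharp (f * fps_sharp f) = f * fps_sharp f" "fps_sharp f * f = f * fps_sharp f"
proof -
  show 1: "fps_sharp (f * fps_sharp f) = f * fps_sharp f" for f
    by (simp add: fps_sharp_mult)
  have "f * (fps_sharp f * f) = f * (f * fps_sharp f)"
    using fps_sharp_eq_imp_central [OF 1, of f f] by (simp add: mult.assoc)
  then show "fps_sharp f * f = f * fps_sharp f" by auto
qed

text \<open>The series \<open>f * fps_sharp f\<close> plays the role of a norm. It is multiplicative
  because the inner norm series is central and can be pulled out from between \<open>p\<close> and
  \<open>fps_sharp p\<close>.\<close>

lemma norm_series_mult:
  "p * h * fps_sharp (p * h) = h * fps_sharp h * (p * fps_sharp p)"
proof -
  have "p * h * fps_sharp (p * h) = p * (h * fps_sharp h) * fps_sharp p"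
    by (simp add: fps_sharp_mult mult.assoc)
  also have "\<dots> = h * fps_sharp h * (p * fps_sharp p)"
    using fps_sharp_eq_imp_central [OF fps_sharp_mult_self(1), of h p] by (metis mult.assoc)
  finally show ?thesis .
qed

lemma power_mult_distrib_central:
  fixes x y :: "'a :: monoid_mult"
  assumes "\<And>z. x * z = z * x"
  shows "(x * y) ^ n = x ^ n * y ^ n"
proof (induction n)
  case (Suc n)
  have "(x * y) ^ Suc n = x * (y * x ^ n) * y ^ n"
    by (simp add: Suc mult.assoc)
  also have "y * x ^ n = x ^ n * y"
    using assms power_commuting_commutes by metis
  finally show ?case by (simp add: mult.assoc)
qed simp

section \<open>Geometric series and elementary properties of Blaschke factors\<close>

abbreviation geom :: "quat \<Rightarrow> quat fps"
  where "geom a \<equiv> Abs_fps (\<lambda>k. a ^ k)"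

abbreviation geom_inv :: "quat \<Rightarrow> quat fps"
  where "geom_inv a \<equiv> 1 - fps_const a * fps_X"

lemma geom_inverse_left:
  "geom a * (geom_inv a * f) = f" "geom_inv a * (geom a * f) = f"
  by (simp_all add: geometric_inverse flip: mult.assoc)

lemma geom_inv_commute:
  assumes "a * b = b * a"
  shows "geom_inv a * (fps_X - fps_const b) = (fps_X - fps_const b) * geom_inv a"
proof -
  have 1: "fps_const a * fps_X * fps_X = fps_X * (fps_const a * fps_X)"
    by (simp only: mult.assoc fps_mult_fps_X_commute [of "fps_const a * fps_X"])
  have 2: "fps_const a * fps_X * fps_const b = fps_const b * (fps_const a * fps_X)"
  proof -
    have "fps_const a * fps_X * fps_const b = fps_const a * fps_const b * fps_X"
      by (simp only: mult.assoc fps_mult_fps_X_commute [of "fps_const b"])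
    also have "\<dots> = fps_const b * fps_const a * fps_X"
      using assms by simp
    finally show ?thesis by (simp only: mult.assoc)
  qed
  have 3: "x - y - (z - w) = x - z - (y - w)" for x y z w :: "quat fps"
    by simp
  show ?thesis
    by (simp only: left_diff_distrib right_diff_distrib mult_1_left mult_1_right 1 2)
      (rule 3)
qed

lemma geom_commute:
  assumes "a * b = b * a"
  shows "geom a * (fps_X - fps_const b) = (fps_X - fps_const b) * geom a"
proof -
  have "geom a * (fps_X - fps_const b) = geom a * ((fps_X - fps_const b) * geom_inv a) * geom a"
    by (simp add: mult.assoc geometric_inverse)
  also have "\<dots> = (fps_X - fps_const b) * geom a"
    by (simp add: geom_inv_commute [OF assms, symmetric] geom_inverse_left)
  finally show ?thesis .
qed

lemma qcnj_commute: "a * qcnj a = qcnj a * a" "qcnj a * a = a * qcnj a"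
  by (simp_all add: quat_mult_qcnj)

lemma H1_geom [simp]: "norm a < 1 \<Longrightarrow> geom a \<in> H1"
  by (simp add: H1_geometric)

lemma fps_sharp_geom: "fps_sharp (geom a) = geom (qcnj a)"
  by (rule fps_ext) (simp add: qcnj_power)

lemma fps_sharp_blaschke: "fps_sharp (blaschke a) = blaschke (qcnj a)"
  by (simp add: blaschke_def fps_sharp_mult fps_sharp_geom fps_sharp_diff geom_commute [OF qcnj_commute(1)])

lemma H1_blaschke [simp]: "norm a < 1 \<Longrightarrow> blaschke a \<in> H1"
  by (simp add: blaschke_def)

lemma fps_X_minus_const_eq: "fps_X - fps_const a = blaschke a * geom_inv (qcnj a)"
  by (simp add: blaschke_def mult.assoc geometric_inverse)

lemma fps_X_minus_const_neq_0: "fps_X - fps_const a \<noteq> (0 :: quat fps)"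
proof
  assume "fps_X - fps_const a = (0 :: quat fps)"
  then have "fps_nth (fps_X - fps_const a) 1 = (0 :: quat)" by simp
  then show False by simp
qed

lemma blaschke_neq_0: "blaschke a \<noteq> 0"
  using fps_X_minus_const_eq fps_X_minus_const_neq_0 by (metis mult_zero_left)

lemma blaschke_pair_commute: "blaschke a * blaschke (qcnj a) * g = g * (blaschke a * blaschke (qcnj a))"
  by (rule fps_sharp_eq_imp_central) (simp add: fps_sharp_mult fps_sharp_blaschke)

lemma blaschke_root:
  assumes "f \<in> H1" "norm a < 1" "eval_left f a = 0"
  shows "\<exists>h\<in>H1. f = blaschke a * h"
proof -
  obtain q where q: "q \<in> H1" "f = (fps_X - fps_const a) * q"
    using assms eval_left_eq_0_iff by blast
  then have "f = blaschke a * (geom_inv (qcnj a) * q)"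
    by (simp add: fps_X_minus_const_eq mult.assoc)
  with q show ?thesis by (intro bexI [of _ "geom_inv (qcnj a) * q"]) auto
qed

lemma eval_left_blaschke_mult:
  assumes "h \<in> H1" "norm a < 1"
  shows "eval_left (blaschke a * h) a = 0"
  using assms eval_left_linear_factor [of "geom (qcnj a) * h" a]
  by (simp add: blaschke_def mult.assoc)

text \<open>The identity |1 - a* z|^2 - |z - a|^2 = (1 - |a|^2)(1 - |z|^2), homogenized with
  \<open>x\<close> for 1 and \<open>y\<close> for z. The cross terms cancel because left
  multiplication by \<open>qcnj a\<close> is adjoint to left multiplication by
  \<open>a\<close>.\<close>

lemma norm_diff_identity:
  "(norm (x - qcnj a * y))\<^sup>2 - (norm (y - a * x))\<^sup>2 = (1 - (norm a)\<^sup>2) * ((norm x)\<^sup>2 - (norm y)\<^sup>2)"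
proof -
  have "inner x (qcnj a * y) = inner y (a * x)"
    by (subst inner_commute) (simp add: inner_quat_eq qcnj_mult mult.assoc qRe_mult_commute)
  then show ?thesis
    by (simp add: power2_norm_eq_inner inner_diff algebra_simps inner_commute)
      (simp add: norm_mult power_mult_distrib algebra_simps flip: power2_norm_eq_inner)
qed

text \<open>For \<open>q = geom (qcnj a) * g\<close> the two series are \<open>g\<close> and
  \<open>blaschke a * g\<close>. Applied to consecutive coefficients of \<open>q\<close>,
  \<open>norm_diff_identity\<close> produces a telescoping sum, and only the term at the cut
  \<open>n\<close> survives as a defect.\<close>

lemma energy_linear_factors:
  "energy n (geom_inv (qcnj a) * q) =
    energy n ((fps_X - fps_const a) * q) + (1 - (norm a)\<^sup>2) * (norm (fps_nth q n))\<^sup>2"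
proof (induction n)
  case 0
  show ?case
    by (simp add: energy_def left_diff_distrib mult.assoc norm_mult power_mult_distrib)
next
  case (Suc n)
  then show ?case
    using norm_diff_identity [of "fps_nth q (Suc n)" a "fps_nth q n"]
    by (simp add: energy_def left_diff_distrib mult.assoc algebra_simps)
qed

lemma schur_blaschke:
  assumes "norm a < 1"
  shows "blaschke a \<in> schur_class"
  unfolding schur_iff_left_contractive left_contractive_def
proof (intro allI)
  fix g n
  have "(1 - (norm a)\<^sup>2) * (norm (fps_nth (geom (qcnj a) * g) n))\<^sup>2 \<ge> 0"
    using assms by (intro mult_nonneg_nonneg) (auto simp: abs_square_le_1)
  then show "energy n (blaschke a * g) \<le> energy n g"
    using energy_linear_factors [of n a "geom (qcnj a) * g"]
    by (simp add: geom_inverse_left blaschke_def mult.assoc)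
qed

text \<open>If \<open>y\<close> denotes the product, then \<open>q\<close> at \<open>k\<close>
  equals \<open>y\<close> at \<open>k + 1\<close> plus \<open>a\<close> times \<open>q\<close> at
  \<open>k + 1\<close>. Iterating upwards expresses the coefficients of \<open>q\<close> by late
  coefficients of \<open>y\<close> plus a remainder with factor \<open>a ^ J\<close>, which vanishes
  in the limit because \<open>q\<close> is in \<open>H1\<close>.\<close>

lemma coeffs_tendsto_0_linear_factor:
  assumes q: "q \<in> H1" and a: "norm a < 1"
    and lim: "(\<lambda>n. norm (fps_nth ((fps_X - fps_const a) * q) n)) \<longlonglongrightarrow> 0"
  shows "(\<lambda>n. norm (fps_nth q n)) \<longlonglongrightarrow> 0"
proof (rule LIMSEQ_I)
  fix e :: real
  assume e: "0 < e"
  define y where "y = (fps_X - fps_const a) * q"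
  define d where "d = e / 2"
  have "d * (1 - norm a) > 0" using a e by (simp add: d_def)
  from LIMSEQ_D [OF lim this] obtain K where
    K: "\<And>n. n \<ge> K \<Longrightarrow> norm (fps_nth y n) \<le> d * (1 - norm a)"
    by (auto simp: y_def intro: less_imp_le)
  have "norm (fps_nth q k) < e" if k: "k \<ge> K" for k
  proof -
    have "norm (fps_nth q k) \<le> d * (1 - norm a ^ J) + norm (a ^ J * fps_nth q (k + J))" for J
    proof (induction J)
      case (Suc J)
      have "fps_nth q (k + J) = fps_nth y (Suc (k + J)) + a * fps_nth q (Suc (k + J))"
        by (simp add: y_def left_diff_distrib)
      also have "norm \<dots> \<le> d * (1 - norm a) + norm a * norm (fps_nth q (Suc (k + J)))"
        using K [of "Suc (k + J)"] k by (intro order_trans [OF norm_triangle_ineq]) (simp add: norm_mult)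
      finally have "norm a ^ J * norm (fps_nth q (k + J)) \<le>
          norm a ^ J * (d * (1 - norm a) + norm a * norm (fps_nth q (Suc (k + J))))"
        by (rule mult_left_mono) simp
      with Suc show ?case by (simp add: norm_mult norm_power algebra_simps)
    qed simp
    moreover have "(\<lambda>J. d * (1 - norm a ^ J) + norm (a ^ J * fps_nth q (k + J))) \<longlonglongrightarrow> d * (1 - 0) + 0"
    proof (intro tendsto_intros LIMSEQ_power_zero tendsto_norm_zero)
      have "fps_shift k q \<in> H1" using q by (simp add: H1_iff)
      from summable_LIMSEQ_zero [OF H1_summable [OF this a]]
      show "(\<lambda>J. a ^ J * fps_nth q (k + J)) \<longlonglongrightarrow> 0" by (simp add: add.commute)
    qed (use a in simp)
    ultimately have "norm (fps_nth q k) \<le> d * (1 - 0) + 0"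
      by (intro LIMSEQ_le_const) auto
    with e show ?thesis by (simp add: d_def)
  qed
  then show "\<exists>no. \<forall>n\<ge>no. norm (norm (fps_nth q n) - 0) < e" by auto
qed

text \<open>Multiplication by a Blaschke factor is isometric on square summable series, the defect
  \<open>(1 - (norm a)\<^sup>2) * (norm (fps_nth q n))\<^sup>2\<close> of the truncated norms tending to 0.\<close>

lemma schur_blaschke_cancel:
  assumes "blaschke a * h \<in> schur_class" "h \<in> H1" "norm a < 1"
  shows "h \<in> schur_class"
  unfolding schur_iff_left_contractive left_contractive_def
proof (intro allI)
  fix g0 :: "quat fps" and n
  define g where "g = fps_cutoff (Suc n) g0"
  define p where "p = h * g"
  define q where "q = geom (qcnj a) * p"
  have nth_g: "fps_nth g k = (if k \<le> n then fps_nth g0 k else 0)" for k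
    by (simp add: g_def less_Suc_eq_le)
  have "g \<in> H1"
  proof (rule H1_bounded_coeffs)
    show "norm (fps_nth g k) \<le> (\<Sum>k\<le>n. norm (fps_nth g0 k))" for k
      by (auto simp: nth_g sum_nonneg intro: member_le_sum)
  qed
  with assms have q: "q \<in> H1" by (simp add: q_def p_def)
  have y: "(fps_X - fps_const a) * q = (blaschke a * h) * g"
    by (simp add: q_def p_def blaschke_def mult.assoc)
  have energy_y: "energy N ((fps_X - fps_const a) * q) \<le> energy n g" if "N \<ge> n" for N
  proof -
    have "energy N ((fps_X - fps_const a) * q) \<le> energy N g"
      unfolding y using assms by (simp add: schur_iff_left_contractive left_contractive_def)
    also have "energy N g = energy n g"
      unfolding energy_def using that by (intro sum.mono_neutral_right) (auto simp: nth_g)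
    finally show ?thesis .
  qed
  have "summable (\<lambda>k. (norm (fps_nth ((fps_X - fps_const a) * q) k))\<^sup>2)"
  proof (rule summableI_nonneg_bounded)
    fix N
    have "(\<Sum>k<N. (norm (fps_nth ((fps_X - fps_const a) * q) k))\<^sup>2) \<le>
        energy (n + N) ((fps_X - fps_const a) * q)"
      unfolding energy_def by (rule sum_mono2) auto
    also have "\<dots> \<le> energy n g" by (rule energy_y) simp
    finally show "(\<Sum>k<N. (norm (fps_nth ((fps_X - fps_const a) * q) k))\<^sup>2) \<le> energy n g" .
  qed simp
  from tendsto_real_sqrt [OF summable_LIMSEQ_zero [OF this]]
  have "(\<lambda>k. norm (fps_nth ((fps_X - fps_const a) * q) k)) \<longlonglongrightarrow> 0" by simp
  then have "(\<lambda>k. norm (fps_nth q k)) \<longlonglongrightarrow> 0"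
    using q assms coeffs_tendsto_0_linear_factor by blast
  then have "(\<lambda>N. energy n g + (1 - (norm a)\<^sup>2) * (norm (fps_nth q N))\<^sup>2) \<longlonglongrightarrow>
      energy n g + (1 - (norm a)\<^sup>2) * 0\<^sup>2"
    by (intro tendsto_intros)
  moreover have "energy n p \<le> energy n g + (1 - (norm a)\<^sup>2) * (norm (fps_nth q N))\<^sup>2" if "N \<ge> n" for N
  proof -
    have "p = geom_inv (qcnj a) * q" by (simp add: q_def geom_inverse_left)
    then have "energy N p = energy N ((fps_X - fps_const a) * q) + (1 - (norm a)\<^sup>2) * (norm (fps_nth q N))\<^sup>2"
      by (metis energy_linear_factors)
    with energy_mono [OF that, of p] energy_y [OF that] show ?thesis by linarith
  qed
  ultimately have "energy n p \<le> energy n g + (1 - (norm a)\<^sup>2) * 0\<^sup>2"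
    by (intro LIMSEQ_le_const) auto
  moreover have "energy n p = energy n (h * g0)"
    unfolding p_def by (rule energy_cong) (auto simp: fps_mult_nth nth_g intro!: sum.cong)
  moreover have "energy n g = energy n g0"
    by (rule energy_cong) (simp add: nth_g)
  ultimately show "energy n (h * g0) \<le> energy n g0" by simp
qed


section \<open>Zeros in a similarity class\<close>

lemma eval_left_fps_X [simp]: "norm c < 1 \<Longrightarrow> eval_left fps_X c = c"
  using eval_left_linear_factor [of 1 c] by (simp add: eval_left_diff)

lemma eval_left_blaschke_eq_0:
  assumes "norm a < 1" "norm c < 1" "eval_left (blaschke a) c = 0"
  shows "c = a"
proof -
  obtain q where q: "q \<in> H1" "blaschke a = (fps_X - fps_const c) * q"
    using assms eval_left_eq_0_iff H1_blaschke by blast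
  then have "fps_X - fps_const a = (fps_X - fps_const c) * (q * geom_inv (qcnj a))"
    by (simp add: fps_X_minus_const_eq [of a] mult.assoc)
  then have "eval_left (fps_X - fps_const a) c = 0"
    using q assms by (simp add: eval_left_linear_factor)
  then show ?thesis using assms by (simp add: eval_left_diff)
qed

text \<open>Divide \<open>q\<close> by \<open>fps_X - fps_const (qcnj a)\<close> with remainder
  \<open>s\<close>. The quotient then stands behind the quadratic of the class, which can equally be
  written with \<open>c\<close> and so vanishes at \<open>c\<close>. What remains is
  \<open>(c - a) * s = 0\<close>.\<close>

lemma second_zero_linear_factor:
  assumes "q \<in> H1" "norm a < 1" "c \<in> sim_class a" "c \<noteq> a"
    and zero: "eval_left ((fps_X - fps_const a) * q) c = 0"
  shows "eval_left q (qcnj a) = 0"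
proof -
  have c: "norm c < 1" "qRe c = qRe a" "norm c = norm a"
    using assms by (auto simp: sim_class_iff)
  obtain p where p: "p \<in> H1" "q = (fps_X - fps_const (qcnj a)) * p + fps_const (eval_left q (qcnj a))"
    using eval_left_remainder [of q "qcnj a"] assms by auto
  define s where "s = eval_left q (qcnj a)"
  have "(fps_X - fps_const a) * q =
      (fps_X - fps_const a) * (fps_X - fps_const (qcnj a)) * p + (fps_X - fps_const a) * fps_const s"
    by (subst p(2)) (simp only: s_def distrib_left mult.assoc)
  also have "(fps_X - fps_const a) * (fps_X - fps_const (qcnj a)) =
      (fps_X - fps_const c) * (fps_X - fps_const (qcnj c))"
    unfolding quadratic_eq c ..
  finally have "eval_left ((fps_X - fps_const a) * q) c = (c - a) * s"
    using c p by (simp add: eval_left_add mult.assoc eval_left_linear_factor eval_left_mult eval_left_diff)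
  with zero assms show ?thesis by (simp add: s_def)
qed

lemma second_zero_blaschke:
  assumes "h \<in> H1" "norm a < 1" "c \<in> sim_class a" "c \<noteq> a" "eval_left (blaschke a * h) c = 0"
  shows "eval_left h (qcnj a) = 0"
proof -
  have "eval_left (geom (qcnj a) * h) (qcnj a) = 0"
    by (rule second_zero_linear_factor) (use assms in \<open>auto simp: blaschke_def mult.assoc\<close>)
  then obtain p where p: "p \<in> H1" "geom (qcnj a) * h = (fps_X - fps_const (qcnj a)) * p"
    using assms eval_left_eq_0_iff [of "geom (qcnj a) * h" "qcnj a"] by auto
  then have "h = geom_inv (qcnj a) * ((fps_X - fps_const (qcnj a)) * p)"
    by (metis geom_inverse_left(2))
  also have "\<dots> = (fps_X - fps_const (qcnj a)) * (geom_inv (qcnj a) * p)"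
    by (simp add: geom_inv_commute flip: mult.assoc)
  finally show ?thesis
    using eval_left_linear_factor [of "geom_inv (qcnj a) * p" "qcnj a"] p assms by simp
qed

lemma has_zero_at_norm: "has_zero_at f c \<Longrightarrow> norm c < 1"
  by (simp add: has_zero_at_def)

text \<open>By \<open>eval_left_mult\<close>, either \<open>f\<close> vanishes at \<open>a\<close>
  or \<open>fps_sharp f\<close> vanishes at a conjugate of \<open>a\<close>. The latter is a right
  zero of \<open>f\<close> at the quaternion conjugate of that point.\<close>

lemma zero_of_norm_series:
  assumes "f \<in> H1" "norm a < 1" "eval_left (f * fps_sharp f) a = 0"
  shows "\<exists>c\<in>sim_class a. has_zero_at f c"
proof (cases "eval_left f a = 0")
  case True
  with assms show ?thesis
    by (intro bexI [of _ a]) (auto simp: has_zero_at_iff self_in_sim_class)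
next
  case False
  define w where "w = eval_left f a"
  define c where "c = qcnj (inverse w * a * w)"
  have "c \<in> sim_class a"
    unfolding c_def by (intro qcnj_in_sim_class conjugate_in_sim_class) (use False w_def in simp)
  moreover from this have "norm c < 1" using assms by (simp add: sim_class_iff)
  moreover have "eval_left (fps_sharp f) (qcnj c) = 0"
    using assms False by (simp add: eval_left_mult c_def w_def)
  ultimately show ?thesis using assms by (auto simp: has_zero_at_iff)
qed

text \<open>This makes it enough to look for left zeros in a class. If \<open>c\<close> is a right
  zero, the norm series vanishes at \<open>c\<close>; written as \<open>fps_sharp f * f\<close>, it
  yields a left zero of \<open>f\<close> at a conjugate of \<open>c\<close> unless
  \<open>fps_sharp f\<close> vanishes at \<open>c\<close>. In that case \<open>fps_sharp f\<close>
  vanishes at both \<open>c\<close> and \<open>qcnj c\<close>, so a central factor divides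
  \<open>f\<close>: the class quadratic, or a linear factor if \<open>c\<close> is real. Then
  \<open>c\<close> itself is a left zero.\<close>

lemma zero_imp_left_zero:
  assumes "f \<in> H1" "has_zero_at f c"
  shows "\<exists>a\<in>sim_class c. eval_left f a = 0"
proof (cases "eval_left f c = 0")
  case True
  then show ?thesis using self_in_sim_class by blast
next
  case False
  define d where "d = qcnj c"
  have d: "norm d < 1" "eval_left (fps_sharp f) d = 0"
    using assms False by (auto simp: has_zero_at_iff d_def)
  then obtain q where q: "q \<in> H1" "fps_sharp f = (fps_X - fps_const d) * q"
    using assms eval_left_eq_0_iff [of "fps_sharp f" d] by auto
  have R: "eval_left (f * fps_sharp f) c = 0"
  proof -
    have "f = fps_sharp ((fps_X - fps_const d) * q)" by (simp flip: q(2))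
    then have "f = fps_sharp q * (fps_X - fps_const c)"
      by (simp add: fps_sharp_mult fps_sharp_diff d_def)
    then have "f * fps_sharp f = fps_sharp q * ((fps_X - fps_const c) * (fps_X - fps_const d)) * q"
      using q(2) by (simp add: mult.assoc)
    also have "\<dots> = (fps_X - fps_const c) * ((fps_X - fps_const d) * (fps_sharp q * q))"
      unfolding d_def
      by (subst fps_sharp_eq_imp_central [symmetric])
        (simp_all add: fps_sharp_mult fps_sharp_diff mult.assoc)
    finally show ?thesis
      using eval_left_linear_factor [of "(fps_X - fps_const d) * (fps_sharp q * q)" c] q d
      by (simp add: d_def)
  qed
  show ?thesis
  proof (cases "eval_left (fps_sharp f) c = 0")
    case True
    show ?thesis
    proof (cases "c = d")
      case True
      have "f = fps_sharp q * (fps_X - fps_const c)"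
        using arg_cong [OF q(2), of fps_sharp] by (simp add: fps_sharp_mult fps_sharp_diff d_def)
      also have "\<dots> = (fps_X - fps_const c) * fps_sharp q"
        by (rule fps_sharp_eq_imp_central [symmetric]) (use True in \<open>simp add: fps_sharp_diff d_def\<close>)
      finally have "eval_left f c = 0"
        using eval_left_linear_factor [of "fps_sharp q" c] q d by (simp add: d_def)
      with False show ?thesis by simp
    next
      case neq: False
      have "eval_left q (qcnj d) = 0"
        by (rule second_zero_linear_factor [where c = c])
          (use q d True neq in \<open>auto simp: d_def sim_class_iff\<close>)
      then obtain p where p: "p \<in> H1" "q = (fps_X - fps_const c) * p"
        using q d eval_left_eq_0_iff [of q "qcnj d"] by (auto simp: d_def)
      have "fps_sharp f = (fps_X - fps_const d) * ((fps_X - fps_const c) * p)"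
        by (rule q(2) [unfolded p(2)])
      from arg_cong [OF this, of fps_sharp] have "f = fps_sharp p * ((fps_X - fps_const d) * (fps_X - fps_const c))"
        by (simp add: fps_sharp_mult fps_sharp_diff d_def mult.assoc)
      also have "(fps_X - fps_const d) * (fps_X - fps_const c) =
          (fps_X - fps_const c) * (fps_X - fps_const d)"
        using quadratic_eq [of c] quadratic_eq [of d] by (simp add: d_def)
      also have "fps_sharp p * \<dots> = \<dots> * fps_sharp p"
        by (rule fps_sharp_eq_imp_central [symmetric])
          (simp add: fps_sharp_mult fps_sharp_diff d_def)
      finally have "eval_left f c = 0"
        using eval_left_linear_factor [of "(fps_X - fps_const d) * fps_sharp p" c] p d
        by (simp add: d_def mult.assoc)
      with False show ?thesis by simp
    qed
  next
    case nz: False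
    define v where "v = eval_left (fps_sharp f) c"
    have "eval_left (fps_sharp f * f) c = 0"
      using R by (simp add: fps_sharp_mult_self)
    then have "v * eval_left f (inverse v * c * v) = 0"
      using assms by (simp add: eval_left_mult v_def has_zero_at_iff)
    with nz have "eval_left f (inverse v * c * v) = 0" by (simp add: v_def)
    then show ?thesis using conjugate_in_sim_class nz v_def by blast
  qed
qed

text \<open>A zero of \<open>h\<close> need not be a zero of \<open>p * h\<close>, where
  \<open>h\<close> is evaluated at conjugated points. The norm series ignores this shift: that of
  \<open>p * h\<close> has that of \<open>h\<close> as a factor, and
  \<open>zero_of_norm_series\<close> leads back to a zero in the same class.\<close>

lemma zero_mult_left:
  assumes "p \<in> H1" "h \<in> H1" "has_zero_at h c"
  shows "\<exists>d\<in>sim_class c. has_zero_at (p * h) d"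
proof -
  obtain a where a: "a \<in> sim_class c" "eval_left h a = 0"
    using zero_imp_left_zero assms by blast
  then have na: "norm a < 1" using assms by (simp add: has_zero_at_norm sim_class_iff)
  then obtain q where q: "q \<in> H1" "h = (fps_X - fps_const a) * q"
    using assms a eval_left_eq_0_iff by blast
  have "p * h * fps_sharp (p * h) = h * fps_sharp h * (p * fps_sharp p)"
    by (rule norm_series_mult)
  also have "\<dots> = (fps_X - fps_const a) * (q * fps_sharp h * (p * fps_sharp p))"
    by (subst (1) q(2)) (simp add: mult.assoc)
  finally have "eval_left (p * h * fps_sharp (p * h)) a = 0"
    using na q assms by (simp add: eval_left_linear_factor)
  then have "\<exists>d\<in>sim_class a. has_zero_at (p * h) d"
    using assms na by (intro zero_of_norm_series) auto
  then show ?thesis using a sim_class_eq by blast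
qed


section \<open>Products of Blaschke factors\<close>

abbreviation bprod :: "quat list \<Rightarrow> quat fps"
  where "bprod as \<equiv> prod_list (map blaschke as)"

lemma schur_bprod: "\<forall>b\<in>set as. norm b < 1 \<Longrightarrow> bprod as \<in> schur_class"
  by (induction as) (use schur_const [of 1] in \<open>auto intro: schur_mult schur_blaschke\<close>)

lemma H1_bprod: "\<forall>b\<in>set as. norm b < 1 \<Longrightarrow> bprod as \<in> H1"
  by (rule schur_imp_H1 [OF schur_bprod])

lemma norm_less_1_if_subset_sim_class:
  "set as \<subseteq> sim_class a \<Longrightarrow> norm a < 1 \<Longrightarrow> \<forall>b\<in>set as. norm b < 1"
  by (auto simp: sim_class_iff)

lemma bprod_neq_0: "bprod as \<noteq> 0"
  by (induction as) (auto simp: blaschke_neq_0)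

lemma fps_sharp_bprod: "fps_sharp (bprod as) = bprod (rev (map qcnj as))"
  by (induction as) (simp_all add: fps_sharp_mult fps_sharp_blaschke)

lemma blaschke_class_sim_class:
  "b \<in> sim_class a \<Longrightarrow> blaschke_class (sim_class a) = blaschke b * blaschke (qcnj b)"
  using blaschke_class_eq by blast

lemma blaschke_class_central: "blaschke_class (sim_class a) * g = g * blaschke_class (sim_class a)"
  using blaschke_pair_commute blaschke_class_sim_class [OF self_in_sim_class] by metis

lemma blaschke_class_power_central:
  "blaschke_class (sim_class a) ^ n * g = g * blaschke_class (sim_class a) ^ n"
  by (rule power_commuting_commutes [OF blaschke_class_central])

lemma blaschke_class_neq_0: "blaschke_class (sim_class a) \<noteq> 0"
  by (simp add: blaschke_class_sim_class [OF self_in_sim_class] blaschke_neq_0)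

lemma fps_sharp_blaschke_class: "fps_sharp (blaschke_class (sim_class a)) = blaschke_class (sim_class a)"
  by (simp add: blaschke_class_sim_class [OF self_in_sim_class] fps_sharp_mult fps_sharp_blaschke)

lemma H1_blaschke_class: "norm a < 1 \<Longrightarrow> blaschke_class (sim_class a) \<in> H1"
  by (simp add: blaschke_class_sim_class [OF self_in_sim_class])

lemma blaschke_class_power_eq_bprod:
  "blaschke_class (sim_class a) ^ n = bprod (concat (replicate n [a, qcnj a]))"
  by (induction n) (simp_all add: blaschke_class_sim_class [OF self_in_sim_class] mult.assoc)

lemma set_replicate_pair: "set (concat (replicate n [a, qcnj a])) \<subseteq> sim_class a"
  by (auto simp: sim_class_iff)

lemma length_replicate_pair: "length (concat (replicate n [a, qcnj a])) = 2 * n"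
  by (induction n) auto

lemma bprod_norm_series:
  "set as \<subseteq> sim_class a \<Longrightarrow>
    bprod as * fps_sharp (bprod as) = blaschke_class (sim_class a) ^ length as"
proof (induction as)
  case (Cons b as)
  have "bprod (b # as) * fps_sharp (bprod (b # as)) =
      bprod as * fps_sharp (bprod as) * (blaschke b * fps_sharp (blaschke b))"
    using norm_series_mult [of "blaschke b" "bprod as"] by simp
  also have "\<dots> = blaschke_class (sim_class a) ^ length as * (blaschke b * blaschke (qcnj b))"
    using Cons by (simp add: fps_sharp_blaschke)
  also have "blaschke b * blaschke (qcnj b) = blaschke_class (sim_class a)"
    using Cons.prems by (intro blaschke_class_sim_class [symmetric]) simp
  finally show ?case by (simp add: power_commutes)
qed simp

lemma schur_bprod_cancel:
  assumes "bprod as * h \<in> schur_class" "h \<in> H1" "\<forall>b\<in>set as. norm b < 1"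
  shows "h \<in> schur_class"
  using assms
proof (induction as)
  case (Cons b as)
  have "bprod as * h \<in> schur_class"
  proof (rule schur_blaschke_cancel)
    show "blaschke b * (bprod as * h) \<in> schur_class"
      using Cons.prems(1) by (simp add: mult.assoc)
    show "bprod as * h \<in> H1" "norm b < 1"
      using Cons.prems H1_bprod [of as] by auto
  qed
  then show ?case using Cons.prems by (intro Cons.IH) auto
qed simp

lemma zero_of_const_mult:
  assumes "h \<in> H1" "u \<noteq> 0" "has_zero_at (fps_const u * h) c"
  shows "\<exists>d\<in>sim_class c. has_zero_at h d"
proof -
  obtain d where d: "d \<in> sim_class c" "eval_left (fps_const u * h) d = 0"
    using zero_imp_left_zero [OF _ assms(3)] assms by auto
  then have nd: "norm d < 1" using assms by (simp add: has_zero_at_norm sim_class_iff)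
  then have "eval_left h (inverse u * d * u) = 0"
    using d assms by (simp add: eval_left_const_mult)
  moreover have "inverse u * d * u \<in> sim_class c"
    using conjugate_in_sim_class [OF assms(2), of d] sim_class_eq [OF d(1)] by simp
  ultimately show ?thesis
    using nd assms by (metis has_zero_at_def norm_conjugate)
qed

lemma zeros_of_bprod:
  assumes as: "set as \<subseteq> sim_class a" and a: "norm a < 1" and u: "u \<noteq> 0"
    and zero: "has_zero_at (bprod as * fps_const u) c"
  shows "c \<in> sim_class a"
proof -
  have left: "d \<in> sim_class a"
    if "norm d < 1" "eval_left (bprod as * fps_const u) d = 0" for d
    using as that
  proof (induction as arbitrary: d)
    case (Cons b as)
    have b: "norm b < 1" "\<forall>b\<in>set as. norm b < 1"
      using Cons.prems(1) norm_less_1_if_subset_sim_class [OF _ a, of "b # as"] by auto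
    define w where "w = eval_left (blaschke b) d"
    show ?case
    proof (cases "w = 0")
      case True
      then show ?thesis using eval_left_blaschke_eq_0 [of b d] b Cons.prems w_def by auto
    next
      case False
      have "eval_left (blaschke b * (bprod as * fps_const u)) d = 0"
        using Cons.prems by (simp add: mult.assoc)
      then have "w * eval_left (bprod as * fps_const u) (inverse w * d * w) = 0"
        using Cons.prems b H1_bprod [of as] unfolding w_def by (subst (asm) eval_left_mult) auto
      with False have "inverse w * d * w \<in> sim_class a"
        using Cons.prems by (intro Cons.IH) (auto simp: norm_conjugate)
      moreover have "inverse w * d * w \<in> sim_class d"
        using False by (rule conjugate_in_sim_class)
      ultimately show ?thesis by (simp add: sim_class_iff)
    qed
  qed (use u in simp)
  have "bprod as \<in> H1" by (rule H1_bprod [OF norm_less_1_if_subset_sim_class [OF as a]])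
  then obtain d where "d \<in> sim_class c" "eval_left (bprod as * fps_const u) d = 0"
    using zero_imp_left_zero [OF _ zero] by auto
  moreover from this have "norm d < 1" using zero by (simp add: has_zero_at_norm sim_class_iff)
  ultimately have "d \<in> sim_class a" by (intro left)
  with \<open>d \<in> sim_class c\<close> show ?thesis by (simp add: sim_class_iff)
qed

text \<open>Only the first entry of the list is visibly a zero of the product. The zeros of the tail
  may be moved by the first factor, but by \<open>zero_mult_left\<close> they leave a trace in their
  own class.\<close>

lemma bprod_subset_if_zeros_subset:
  assumes "{c. has_zero_at (bprod as * fps_const u) c} \<subseteq> sim_class a" "\<forall>b\<in>set as. norm b < 1"
  shows "set as \<subseteq> sim_class a"
  using assms
proof (induction as)
  case (Cons b as)
  have H1: "bprod as * fps_const u \<in> H1" using Cons.prems H1_bprod [of as] by auto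
  have "eval_left (bprod (b # as) * fps_const u) b = 0"
    using Cons.prems H1 eval_left_blaschke_mult [of "bprod as * fps_const u" b]
    by (simp add: mult.assoc)
  then have "b \<in> sim_class a"
    using Cons.prems by (auto simp: has_zero_at_def)
  moreover have "set as \<subseteq> sim_class a"
  proof (rule Cons.IH)
    show "{c. has_zero_at (bprod as * fps_const u) c} \<subseteq> sim_class a"
    proof
      fix c
      assume "c \<in> {c. has_zero_at (bprod as * fps_const u) c}"
      then obtain d where "d \<in> sim_class c" "has_zero_at (blaschke b * (bprod as * fps_const u)) d"
        using zero_mult_left [of "blaschke b" "bprod as * fps_const u" c] H1 Cons.prems by auto
      moreover from this have "d \<in> sim_class a"
        using Cons.prems(1) by (auto simp: mult.assoc)
      ultimately show "c \<in> sim_class a" by (simp add: sim_class_iff)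
    qed
  qed (use Cons.prems in simp)
  ultimately show ?case by simp
qed simp


section \<open>Existence and uniqueness of the factorization\<close>

lemma number_of_factors_bounded:
  assumes "f \<noteq> 0" "norm a < 1"
  shows "\<exists>N. \<forall>as h. set as \<subseteq> sim_class a \<longrightarrow> h \<in> schur_class \<longrightarrow> f = bprod as * h \<longrightarrow> length as \<le> N"
proof (cases "a = 0")
  case True
  have "geom 0 = 1"
    by (rule fps_ext) (simp add: power_0_left)
  then have b0: "blaschke 0 = fps_X"
    using fps_X_minus_const_eq [of 0] by (simp add: blaschke_def)
  have "length as \<le> subdegree f" if "set as \<subseteq> sim_class a" "f = bprod as * h" for as h
  proof -
    have "\<forall>b\<in>set as. b = 0"
      using that(1) True by (auto simp: sim_class_iff)
    then have "bprod as = fps_X ^ length as"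
      by (induction as) (auto simp: b0)
    with that(2) assms show ?thesis by (auto simp: subdegree_power)
  qed
  then show ?thesis by blast
next
  case False
  define m where "m = subdegree f"
  have "norm (fps_nth f m) > 0" using assms by (simp add: m_def)
  then obtain N where N: "norm a ^ N < norm (fps_nth f m)"
    using assms real_arch_pow_inv by blast
  have "length as \<le> N" if as: "set as \<subseteq> sim_class a" and h: "h \<in> schur_class" and f: "f = bprod as * h" for as h
  proof -
    have nth0: "norm (fps_nth (bprod as) 0) = norm a ^ length as"
      using as by (induction as) (auto simp: norm_mult blaschke_def sim_class_iff)
    then have "fps_nth (bprod as) 0 \<noteq> 0" using False by (metis norm_eq_zero power_not_zero)
    then have "subdegree (bprod as) = 0" by (simp add: subdegree_eq_0)
    moreover have "h \<noteq> 0" using f assms by auto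
    ultimately have "m = subdegree h"
      unfolding m_def f by (simp add: bprod_neq_0)
    then have "norm (fps_nth f m) = norm a ^ length as * norm (fps_nth h m)"
      using nth0 by (simp add: f norm_mult)
    also have "\<dots> \<le> norm a ^ length as"
      using h by (intro mult_left_le) (auto simp: schur_iff_left_contractive left_contractive_coeff_le)
    finally have "norm a ^ N < norm a ^ length as" using N by simp
    then show ?thesis
      using assms by (meson less_imp_le not_less norm_ge_zero power_decreasing nat_le_linear)
  qed
  then show ?thesis by blast
qed

lemma exists_factorization:
  assumes f: "f \<in> schur_class" "f \<noteq> 0" and a: "norm a < 1"
  obtains as h where "set as \<subseteq> sim_class a" "h \<in> schur_class"
    "\<forall>c\<in>sim_class a. \<not> has_zero_at h c" "f = bprod as * h"
proof -
  define P where "P = (\<lambda>n. \<exists>as h. set as \<subseteq> sim_class a \<and> h \<in> schur_class \<and> f = bprod as * h \<and> length as = n)"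
  obtain N where N: "\<And>n. P n \<Longrightarrow> n \<le> N"
    using number_of_factors_bounded [OF f(2) a] unfolding P_def by blast
  have "P 0" unfolding P_def using f by (intro exI [of _ "[]"] exI [of _ f]) simp
  then have "P (Greatest P)" using GreatestI_nat [of P 0 N] N by blast
  then obtain as h where *: "set as \<subseteq> sim_class a" "h \<in> schur_class" "f = bprod as * h"
    "length as = Greatest P" unfolding P_def by blast
  have "\<not> has_zero_at h c" if c: "c \<in> sim_class a" for c
  proof
    assume "has_zero_at h c"
    then obtain b where b: "b \<in> sim_class c" "eval_left h b = 0"
      using zero_imp_left_zero * schur_imp_H1 by blast
    then have ba: "b \<in> sim_class a" "norm b < 1" using c a by (auto simp: sim_class_iff)
    then obtain k where k: "k \<in> H1" "h = blaschke b * k"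
      using b * blaschke_root schur_imp_H1 by blast
    then have "k \<in> schur_class" using * ba schur_blaschke_cancel by blast
    then have "P (Suc (length as))"
      unfolding P_def using *(1,3) k ba
      by (intro exI [of _ "as @ [b]"] exI [of _ k]) (simp add: mult.assoc)
    then have "Suc (length as) \<le> Greatest P" using N by (rule Greatest_le_nat)
    with *(4) show False by simp
  qed
  with * show ?thesis using that by blast
qed

text \<open>Suppose the lists begin with different entries \<open>b\<close> and \<open>c\<close>.
  The product vanishes at both, so the remaining products vanish at \<open>qcnj b\<close> and
  \<open>qcnj c\<close>, and cancelling the common central pair leaves one series \<open>g\<close>.
  A factorization \<open>ds\<close> of \<open>g\<close> links the two tails. Equality of lengths
  belongs to the conclusion because the induction needs the length of \<open>ds\<close>.\<close>

lemma factorization_unique: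
  assumes a: "norm a < 1"
  shows "set as \<subseteq> sim_class a \<Longrightarrow> set cs \<subseteq> sim_class a \<Longrightarrow> h \<in> schur_class \<Longrightarrow> k \<in> schur_class \<Longrightarrow>
    \<forall>c\<in>sim_class a. \<not> has_zero_at h c \<Longrightarrow> \<forall>c\<in>sim_class a. \<not> has_zero_at k c \<Longrightarrow>
    bprod as * h = bprod cs * k \<Longrightarrow> bprod as = bprod cs \<and> h = k \<and> length as = length cs"
proof (induction "length as" arbitrary: as cs h k)
  case 0
  have "cs = []"
  proof (rule ccontr)
    assume "cs \<noteq> []"
    then obtain c cs' where cs: "cs = c # cs'" by (cases cs) auto
    have "norm c < 1" "bprod cs' \<in> H1"
      using norm_less_1_if_subset_sim_class [OF "0.prems"(2) a] by (auto simp: cs H1_bprod)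
    then have "eval_left (bprod cs * k) c = 0"
      using eval_left_blaschke_mult [of "bprod cs' * k" c] schur_imp_H1 [OF "0.prems"(4)]
      by (simp add: cs mult.assoc)
    moreover have "h = bprod cs * k" using "0.prems"(7) "0.hyps" by simp
    ultimately have "has_zero_at h c" using \<open>norm c < 1\<close> by (simp add: has_zero_at_def)
    then show False using "0.prems"(2,5) by (simp add: cs)
  qed
  then show ?case using "0.prems"(7) "0.hyps" by simp
next
  case (Suc n)
  from Suc.hyps(2) obtain b as' where as: "as = b # as'" by (cases as) auto
  have norms: "\<forall>b\<in>set as. norm b < 1" "\<forall>c\<in>set cs. norm c < 1"
    by (rule norm_less_1_if_subset_sim_class [OF Suc.prems(1) a]
        norm_less_1_if_subset_sim_class [OF Suc.prems(2) a])+
  have b: "b \<in> sim_class a" "norm b < 1" "set as' \<subseteq> sim_class a" "bprod as' \<in> H1" "length as' = n"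
    using Suc.prems(1) Suc.hyps(2) norms by (auto simp: as H1_bprod)
  have hk: "h \<in> H1" "k \<in> H1" using Suc.prems(3,4) schur_imp_H1 by auto
  have zero_b: "eval_left (bprod as * h) b = 0"
    using eval_left_blaschke_mult [of "bprod as' * h" b] b hk by (simp add: as mult.assoc)
  have "cs \<noteq> []"
    using zero_b Suc.prems(6,7) b(1,2) by (auto simp: has_zero_at_def)
  then obtain c cs' where cs: "cs = c # cs'" by (cases cs) auto
  have c: "c \<in> sim_class a" "norm c < 1" "set cs' \<subseteq> sim_class a" "bprod cs' \<in> H1"
    using Suc.prems(2) norms by (auto simp: cs H1_bprod)
  have eq: "blaschke b * (bprod as' * h) = blaschke c * (bprod cs' * k)"
    using Suc.prems(7) by (simp add: as cs mult.assoc)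
  show ?case
  proof (cases "b = c")
    case True
    then have "bprod as' * h = bprod cs' * k"
      using eq blaschke_neq_0 by simp
    then have "bprod as' = bprod cs' \<and> h = k \<and> length as' = length cs'"
      using b c Suc.prems(3-6) by (intro Suc.hyps(1)) auto
    then show ?thesis by (simp add: as cs True)
  next
    case False
    have "eval_left (bprod as' * h) (qcnj b) = 0"
    proof (rule second_zero_blaschke [where c = c])
      show "eval_left (blaschke b * (bprod as' * h)) c = 0"
        unfolding eq using c hk by (intro eval_left_blaschke_mult) auto
    qed (use b c hk False in \<open>auto simp: sim_class_iff\<close>)
    then obtain g where g: "g \<in> H1" "bprod as' * h = blaschke (qcnj b) * g"
      using blaschke_root [of "bprod as' * h" "qcnj b"] b hk by auto
    have "eval_left (bprod cs' * k) (qcnj c) = 0"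
    proof (rule second_zero_blaschke [where c = b])
      show "eval_left (blaschke c * (bprod cs' * k)) b = 0"
        unfolding eq [symmetric] using b hk by (intro eval_left_blaschke_mult) auto
    qed (use b c hk False in \<open>auto simp: sim_class_iff\<close>)
    then obtain g' where g': "g' \<in> H1" "bprod cs' * k = blaschke (qcnj c) * g'"
      using blaschke_root [of "bprod cs' * k" "qcnj c"] c hk by auto
    have pair: "blaschke b * blaschke (qcnj b) = blaschke c * blaschke (qcnj c)"
      using blaschke_class_sim_class b c by metis
    have "blaschke b * blaschke (qcnj b) * g = blaschke b * blaschke (qcnj b) * g'"
      using eq unfolding g g' by (metis mult.assoc pair)
    then have "g' = g" using blaschke_neq_0 by auto
    have "bprod as' * h \<in> schur_class"
      using Suc.prems(3) norms as by (auto intro: schur_mult schur_bprod)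
    then have "g \<in> schur_class"
      using g b schur_blaschke_cancel [of "qcnj b" g] by simp
    moreover have "g \<noteq> 0"
    proof
      assume "g = 0"
      then have "h = 0" using g bprod_neq_0 by auto
      then show False using Suc.prems(5) b(1,2) by (auto simp: has_zero_at_def)
    qed
    ultimately obtain ds m where ds: "set ds \<subseteq> sim_class a" "m \<in> schur_class"
      "\<forall>c\<in>sim_class a. \<not> has_zero_at m c" "g = bprod ds * m"
      using exists_factorization a by metis
    have 1: "bprod as' = bprod (qcnj b # ds) \<and> h = m \<and> length as' = length (qcnj b # ds)"
      using b ds Suc.prems(3,5) g
      by (intro Suc.hyps(1)) (auto simp: qcnj_in_sim_class mult.assoc)
    \<comment> \<open>The induction hypothesis requires a first list of length \<open>n\<close>, and
      \<open>length cs'\<close> is not known yet. By \<open>1\<close> the list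
      \<open>qcnj c # ds\<close> has that length, hence the order of the two sides.\<close>
    have 2: "bprod (qcnj c # ds) = bprod cs' \<and> m = k \<and> length (qcnj c # ds) = length cs'"
      using b c ds Suc.prems(4,6) g' \<open>g' = g\<close> 1
      by (intro Suc.hyps(1)) (auto simp: qcnj_in_sim_class mult.assoc)
    have "bprod as = blaschke b * blaschke (qcnj b) * bprod ds"
      using 1 by (simp add: as mult.assoc)
    also have "\<dots> = bprod cs"
      using 2 by (simp add: pair cs mult.assoc)
    finally show ?thesis using 1 2 by (simp add: as cs)
  qed
qed


section \<open>Spherical chains\<close>

lemma spherical_chain_Nil [simp]: "spherical_chain V []"
  by (simp add: spherical_chain_def)

lemma spherical_chain_Cons:
  "spherical_chain V (b # bs) \<longleftrightarrow>
    b \<in> V \<and> spherical_chain V bs \<and> (bs \<noteq> [] \<longrightarrow> hd bs \<noteq> qcnj b)"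
proof -
  have "(\<forall>j. P j) \<longleftrightarrow> P 0 \<and> (\<forall>j. P (Suc j))" for P :: "nat \<Rightarrow> bool"
    by (metis not0_implies_Suc)
  from this [of "\<lambda>j. Suc j < length (b # bs) \<longrightarrow> (b # bs) ! Suc j \<noteq> qcnj ((b # bs) ! j)"]
  show ?thesis by (auto simp: spherical_chain_def hd_conv_nth)
qed

lemma spherical_chain_map_qcnj:
  "spherical_chain (sim_class a) (map qcnj as) \<longleftrightarrow> spherical_chain (sim_class a) as"
proof -
  have "qcnj x = y \<longleftrightarrow> x = qcnj y" for x y by auto
  then show ?thesis by (auto simp: spherical_chain_def sim_class_iff)
qed

lemma spherical_chain_left_zero:
  assumes "spherical_chain (sim_class a) as" "norm a < 1" "c \<in> sim_class a"
    "eval_left (bprod as) c = 0"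
  shows "as \<noteq> [] \<and> c = hd as"
  using assms
proof (induction as arbitrary: c)
  case (Cons b bs)
  have b: "b \<in> sim_class a" "norm b < 1" "spherical_chain (sim_class a) bs"
    using Cons.prems by (auto simp: spherical_chain_Cons sim_class_iff)
  have "c = b"
  proof (rule ccontr)
    assume "c \<noteq> b"
    have "eval_left (bprod bs) (qcnj b) = 0"
    proof (rule second_zero_blaschke [where c = c])
      show "bprod bs \<in> H1"
        using b(3) assms(2) norm_less_1_if_subset_sim_class
        by (intro H1_bprod) (auto simp: spherical_chain_def)
    qed (use b Cons.prems \<open>c \<noteq> b\<close> in \<open>auto simp: sim_class_iff\<close>)
    then have "bs \<noteq> [] \<and> qcnj b = hd bs"
      using b assms(2) qcnj_in_sim_class by (intro Cons.IH) auto
    then show False using Cons.prems by (auto simp: spherical_chain_Cons)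
  qed
  then show ?case by simp
qed simp

lemma spherical_chain_unique:
  assumes "spherical_chain (sim_class a) as" "spherical_chain (sim_class a) cs" "norm a < 1"
    "bprod as = bprod cs"
  shows "as = cs"
  using assms
proof (induction as arbitrary: cs)
  have hd_zero: "eval_left (bprod (b # bs)) b = 0"
    if "spherical_chain (sim_class a) (b # bs)" for b bs
    using that assms(3) norm_less_1_if_subset_sim_class [of "b # bs" a]
      eval_left_blaschke_mult [of "bprod bs" b]
    by (auto simp: spherical_chain_def H1_bprod)
  {
    case Nil
    then show ?case using hd_zero by (cases cs) force+
  next
    case (Cons b bs)
    have "eval_left (bprod cs) b = 0" "b \<in> sim_class a"
      using Cons.prems hd_zero [of b bs] by (auto simp: spherical_chain_def)
    then have "cs \<noteq> [] \<and> b = hd cs"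
      using Cons.prems by (intro spherical_chain_left_zero)
    then obtain ds where "cs = b # ds" by (cases cs) auto
    then show ?case
      using Cons blaschke_neq_0 by (simp add: spherical_chain_Cons)
  }
qed

text \<open>An adjacent conjugate pair multiplies to the central factor, which can be pulled to the
  front. Hence a chain is what remains after the full central power has been removed.\<close>

lemma not_spherical_chain_imp:
  assumes "set as \<subseteq> sim_class a" "\<not> spherical_chain (sim_class a) as" "norm a < 1"
  shows "\<exists>g\<in>H1. bprod as = blaschke_class (sim_class a) * g"
proof -
  obtain j where j: "Suc j < length as" "as ! Suc j = qcnj (as ! j)"
    using assms by (auto simp: spherical_chain_def)
  define xs ys b where "xs = take j as" and "ys = drop (Suc (Suc j)) as" and "b = as ! j"
  have as: "as = xs @ b # qcnj b # ys"
    using j by (simp add: xs_def ys_def b_def Cons_nth_drop_Suc flip: j(2))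
  have b: "b \<in> sim_class a" using assms as by auto
  have "bprod as = bprod xs * (blaschke_class (sim_class a) * bprod ys)"
    by (simp add: as blaschke_class_sim_class [OF b] mult.assoc)
  also have "\<dots> = blaschke_class (sim_class a) * (bprod xs * bprod ys)"
    by (metis blaschke_class_central mult.assoc)
  finally show ?thesis
    using norm_less_1_if_subset_sim_class [OF assms(1,3)]
    by (intro bexI [of _ "bprod xs * bprod ys"]) (auto simp: as H1_bprod)
qed


section \<open>Spherical multiplicities\<close>

text \<open>The two series differ by a unit of \<open>H1\<close>, so spherical multiplicities can be
  computed with \<open>blaschke_class\<close>, which stays within the Schur class.\<close>

lemma class_poly_blaschke_class:
  assumes "norm a < 1"
  shows "\<exists>u\<in>H1. \<exists>w\<in>H1. blaschke_class (sim_class a) = class_poly (sim_class a) * u \<and>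
    class_poly (sim_class a) = blaschke_class (sim_class a) * w"
proof -
  define u w where "u = geom (qcnj a) * geom a" and "w = geom_inv a * geom_inv (qcnj a)"
  have X: "class_poly (sim_class a) = (fps_X - fps_const a) * (fps_X - fps_const (qcnj a))"
    using class_poly_eq(1) self_in_sim_class by blast
  have "blaschke_class (sim_class a) =
      (fps_X - fps_const a) * (geom (qcnj a) * (fps_X - fps_const (qcnj a))) * geom a"
    by (simp add: blaschke_class_sim_class [OF self_in_sim_class] blaschke_def mult.assoc)
  also have "\<dots> = class_poly (sim_class a) * u"
    by (simp add: geom_commute X u_def mult.assoc)
  finally have B: "blaschke_class (sim_class a) = class_poly (sim_class a) * u" .
  have "u * w = 1"
    by (simp add: u_def w_def mult.assoc geom_inverse_left geometric_inverse)
  then have "class_poly (sim_class a) = blaschke_class (sim_class a) * w"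
    by (simp add: B mult.assoc)
  moreover have "u \<in> H1" "w \<in> H1"
    using assms by (simp_all add: u_def w_def)
  ultimately show ?thesis using B by blast
qed

lemma class_poly_central: "class_poly (sim_class a) * g = g * class_poly (sim_class a)"
  unfolding class_poly_eq(1) [OF refl self_in_sim_class]
  by (rule fps_sharp_eq_imp_central) (simp add: fps_sharp_mult fps_sharp_diff)

lemma class_poly_power_dvd_iff:
  assumes "norm a < 1"
  shows "(\<exists>g\<in>H1. f = class_poly (sim_class a) ^ n * g) \<longleftrightarrow>
    (\<exists>g\<in>H1. f = blaschke_class (sim_class a) ^ n * g)"
proof -
  obtain u w where uw: "u \<in> H1" "w \<in> H1" "blaschke_class (sim_class a) = class_poly (sim_class a) * u"
    "class_poly (sim_class a) = blaschke_class (sim_class a) * w"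
    using class_poly_blaschke_class [OF assms] by blast
  have "class_poly (sim_class a) ^ n = blaschke_class (sim_class a) ^ n * w ^ n"
    by (subst uw(4)) (rule power_mult_distrib_central [OF blaschke_class_central])
  moreover have "blaschke_class (sim_class a) ^ n = class_poly (sim_class a) ^ n * u ^ n"
    by (subst uw(3)) (rule power_mult_distrib_central [OF class_poly_central])
  ultimately have "class_poly (sim_class a) ^ n * g = blaschke_class (sim_class a) ^ n * (w ^ n * g)"
    "blaschke_class (sim_class a) ^ n * g = class_poly (sim_class a) ^ n * (u ^ n * g)" for g
    by (metis mult.assoc)+
  moreover have "u ^ n * g \<in> H1" "w ^ n * g \<in> H1" if "g \<in> H1" for g
    using that uw by auto
  ultimately show ?thesis by metis
qed

lemma sph_mult_eq_blaschke_class: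
  "norm a < 1 \<Longrightarrow>
    sph_mult (sim_class a) f = (GREATEST k. \<exists>g\<in>H1. f = blaschke_class (sim_class a) ^ k * g)"
  by (simp add: sph_mult_def class_poly_power_dvd_iff)

lemma sph_mult_eqI:
  assumes a: "norm a < 1" and "g \<in> H1" "f = blaschke_class (sim_class a) ^ n * g"
    and not_dvd: "\<not> (\<exists>q\<in>H1. g = blaschke_class (sim_class a) * q)"
  shows "sph_mult (sim_class a) f = n"
  unfolding sph_mult_eq_blaschke_class [OF a]
proof (rule Greatest_equality)
  fix m
  assume "\<exists>q\<in>H1. f = blaschke_class (sim_class a) ^ m * q"
  then obtain q where q: "q \<in> H1" "f = blaschke_class (sim_class a) ^ m * q" by blast
  show "m \<le> n"
  proof (rule ccontr)
    assume "\<not> m \<le> n"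
    then obtain d where m: "m = n + Suc d" using less_iff_Suc_add by (metis add_Suc_right not_le)
    then have "blaschke_class (sim_class a) ^ n * g =
        blaschke_class (sim_class a) ^ n * (blaschke_class (sim_class a) * (blaschke_class (sim_class a) ^ d * q))"
      unfolding assms(3) [symmetric] by (simp only: q(2) m power_add power_Suc mult.assoc)
    then have "g = blaschke_class (sim_class a) * (blaschke_class (sim_class a) ^ d * q)"
      using blaschke_class_neq_0 by simp
    then show False
      using not_dvd q H1_blaschke_class [OF a] by blast
  qed
qed (use assms in blast)

lemma not_blaschke_class_dvd:
  assumes "\<forall>c\<in>sim_class a. \<not> has_zero_at h c" "h \<in> H1" "norm a < 1"
  shows "\<not> (\<exists>q\<in>H1. h = blaschke_class (sim_class a) * q)"
    and "\<not> (\<exists>q\<in>H1. h * fps_sharp h = blaschke_class (sim_class a) * q)"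
proof -
  have zero: "eval_left (blaschke_class (sim_class a) * q) a = 0" if "q \<in> H1" for q
    using that assms eval_left_blaschke_mult [of "blaschke (qcnj a) * q" a]
    by (simp add: blaschke_class_sim_class [OF self_in_sim_class] mult.assoc)
  show "\<not> (\<exists>q\<in>H1. h = blaschke_class (sim_class a) * q)"
    using assms zero self_in_sim_class by (auto simp: has_zero_at_def)
  show "\<not> (\<exists>q\<in>H1. h * fps_sharp h = blaschke_class (sim_class a) * q)"
    using assms zero zero_of_norm_series by metis
qed

text \<open>Since the central power is maximal, no adjacent conjugate pair is left among the other
  factors. The second multiplicity is read off from the norm series: the factors contribute powers
  of \<open>blaschke_class\<close>, and the norm series of \<open>h\<close> is not divisible by it
  because \<open>h\<close> has no zero in the class.\<close>

lemma spherical_factorization: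
  assumes f: "f \<in> schur_class" "f \<noteq> 0" and a: "norm a < 1"
  obtains as h where "spherical_chain (sim_class a) as" "h \<in> schur_class"
    "\<forall>c\<in>sim_class a. \<not> has_zero_at h c"
    "f = blaschke_class (sim_class a) ^ sph_mult (sim_class a) f * bprod as * h"
    "sph_mult (sim_class a) (f * fps_sharp f) = 2 * sph_mult (sim_class a) f + length as"
proof -
  define B where "B = blaschke_class (sim_class a)"
  define n where "n = sph_mult (sim_class a) f"
  define P where "P = (\<lambda>k. \<exists>g\<in>H1. f = B ^ k * g)"
  have n: "n = Greatest P"
    by (simp add: n_def P_def B_def sph_mult_eq_blaschke_class a)
  have cancel: "g \<in> schur_class" if "g \<in> H1" "f = B ^ k * g" for g k
  proof (rule schur_bprod_cancel)
    show "bprod (concat (replicate k [a, qcnj a])) * g \<in> schur_class"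
      using that(2) f(1) unfolding B_def blaschke_class_power_eq_bprod by (rule subst)
  qed (rule that(1), rule norm_less_1_if_subset_sim_class [OF set_replicate_pair a])
  obtain N where N: "\<And>as h. set as \<subseteq> sim_class a \<Longrightarrow> h \<in> schur_class \<Longrightarrow> f = bprod as * h \<Longrightarrow> length as \<le> N"
    using number_of_factors_bounded [OF f(2) a] by blast
  \<comment> \<open>A power \<open>B ^ k\<close> consists of \<open>2 * k\<close> Blaschke factors.
    Without this bound the \<open>GREATEST\<close> in \<open>sph_mult\<close> would be
    unspecified.\<close>
  have bound: "k \<le> N" if "P k" for k
  proof -
    from that [unfolded P_def] obtain g where g: "g \<in> H1" "f = B ^ k * g" by (rule bexE)
    from g(2) have "f = bprod (concat (replicate k [a, qcnj a])) * g"
      unfolding B_def blaschke_class_power_eq_bprod .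
    then have "length (concat (replicate k [a, qcnj a])) \<le> N"
      by (rule N [OF set_replicate_pair cancel [OF g]])
    then show ?thesis unfolding length_replicate_pair by simp
  qed
  have "P 0" using f schur_imp_H1 by (simp add: P_def)
  then have "P n" unfolding n using bound by (rule GreatestI_nat)
  then obtain g where g: "g \<in> H1" "f = B ^ n * g" by (auto simp: P_def)
  have not_dvd: "\<not> (\<exists>q\<in>H1. g = B * q)"
  proof
    assume "\<exists>q\<in>H1. g = B * q"
    then obtain q where "q \<in> H1" "g = B * q" by blast
    then have "P (Suc n)"
      unfolding P_def using g by (intro bexI [of _ q]) (simp_all add: power_Suc2 mult.assoc del: power_Suc)
    then have "Suc n \<le> n" unfolding n using bound by (rule Greatest_le_nat)
    then show False by simp
  qed
  have "g \<in> schur_class" "g \<noteq> 0" using g f cancel by auto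
  then obtain as h where as: "set as \<subseteq> sim_class a" and h: "h \<in> schur_class"
    "\<forall>c\<in>sim_class a. \<not> has_zero_at h c" and g_eq: "g = bprod as * h"
    using exists_factorization [OF _ _ a] by metis
  have "spherical_chain (sim_class a) as"
  proof (rule ccontr)
    assume "\<not> spherical_chain (sim_class a) as"
    then obtain q where "q \<in> H1" "bprod as = B * q"
      using not_spherical_chain_imp as a unfolding B_def by blast
    then have "g = B * (q * h)" "q * h \<in> H1"
      using g_eq schur_imp_H1 [OF h(1)] by (auto simp: mult.assoc)
    then show False using not_dvd by blast
  qed
  moreover have "f = blaschke_class (sim_class a) ^ sph_mult (sim_class a) f * bprod as * h"
    using g(2) g_eq by (simp add: mult.assoc n_def B_def)
  moreover have "sph_mult (sim_class a) (f * fps_sharp f) = 2 * sph_mult (sim_class a) f + length as"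
  proof (rule sph_mult_eqI [OF a])
    have "fps_sharp (B ^ n) = B ^ n"
      by (simp add: B_def fps_sharp_power fps_sharp_blaschke_class)
    then have "f * fps_sharp f = g * fps_sharp g * (B ^ n * B ^ n)"
      unfolding g(2) norm_series_mult by simp
    also have "g * fps_sharp g = h * fps_sharp h * B ^ length as"
      unfolding g_eq norm_series_mult bprod_norm_series [OF as] B_def ..
    also have "h * fps_sharp h * B ^ length as * (B ^ n * B ^ n) = h * fps_sharp h * B ^ (2 * n + length as)"
      by (simp add: mult.assoc add_ac mult_2 flip: power_add)
    also have "\<dots> = B ^ (2 * n + length as) * (h * fps_sharp h)"
      unfolding B_def by (rule blaschke_class_power_central [symmetric])
    finally show "f * fps_sharp f =
        blaschke_class (sim_class a) ^ (2 * sph_mult (sim_class a) f + length as) * (h * fps_sharp h)"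
      by (simp add: B_def n_def)
  qed (use h a schur_imp_H1 not_blaschke_class_dvd(2) in auto)
  ultimately show ?thesis using that h by blast
qed


section \<open>The left and the right Blaschke factor\<close>

lemma bprod_in_finite_blaschke: "\<forall>b\<in>set as. norm b < 1 \<Longrightarrow> bprod as \<in> finite_blaschke"
  unfolding finite_blaschke_def by (force intro: exI [of _ as] exI [of _ 1])

lemma left_blaschke_factorI:
  assumes "set as \<subseteq> sim_class a" "h \<in> schur_class" "\<forall>c\<in>sim_class a. \<not> has_zero_at h c" "norm a < 1"
  shows "left_blaschke_factor (sim_class a) (bprod as * h) (bprod as)"
  unfolding left_blaschke_factor_def
proof (intro conjI)
  show "bprod as \<in> finite_blaschke"
    by (rule bprod_in_finite_blaschke [OF norm_less_1_if_subset_sim_class [OF assms(1,4)]])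
  show "{c. has_zero_at (bprod as) c} \<subseteq> sim_class a"
    using zeros_of_bprod [OF assms(1,4), of 1] by auto
qed (use assms in blast)

text \<open>The unimodular constant of a competing \<open>B\<close> is absorbed into its cofactor
  \<open>H\<close>. This may conjugate the zeros of \<open>H\<close> but not move them between
  classes, so \<open>factorization_unique\<close> applies to the bare products.\<close>

lemma left_blaschke_factor_unique:
  assumes "left_blaschke_factor (sim_class a) (bprod as * h) B"
    and as: "set as \<subseteq> sim_class a" "h \<in> schur_class" "\<forall>c\<in>sim_class a. \<not> has_zero_at h c"
    and a: "norm a < 1"
  shows "\<exists>u. norm u = 1 \<and> B = bprod as * fps_const u"
    and "B \<in> normalized_finite_blaschke \<Longrightarrow> B = bprod as"
proof -
  obtain H where B: "B \<in> finite_blaschke" "{c. has_zero_at B c} \<subseteq> sim_class a"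
    and H: "H \<in> schur_class" "\<forall>c\<in>sim_class a. \<not> has_zero_at H c" "bprod as * h = B * H"
    using assms(1) by (auto simp: left_blaschke_factor_def)
  have key: "bprod cs = bprod as"
    if cs: "\<forall>b\<in>set cs. norm b < 1" "B = bprod cs * fps_const u" and u: "norm u = 1" for cs u
  proof -
    have "set cs \<subseteq> sim_class a"
      using bprod_subset_if_zeros_subset [of cs u] B(2) cs by blast
    moreover have "fps_const u * H \<in> schur_class"
      using schur_const u H by (intro schur_mult) auto
    moreover have "\<forall>c\<in>sim_class a. \<not> has_zero_at (fps_const u * H) c"
    proof (intro ballI notI)
      fix c
      assume c: "c \<in> sim_class a" "has_zero_at (fps_const u * H) c"
      then obtain d where "d \<in> sim_class c" "has_zero_at H d"
        using zero_of_const_mult [of H u c] H u schur_imp_H1 by force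
      with c H sim_class_eq show False by blast
    qed
    moreover have "bprod cs * (fps_const u * H) = bprod as * h"
      using H cs by (simp add: mult.assoc)
    ultimately show ?thesis using factorization_unique a as by blast
  qed
  show "\<exists>u. norm u = 1 \<and> B = bprod as * fps_const u"
  proof -
    from B(1) obtain cs u where "\<forall>b\<in>set cs. norm b < 1" "B = bprod cs * fps_const u" "norm u = 1"
      unfolding finite_blaschke_def by blast
    with key [of cs u] show ?thesis by auto
  qed
  show "B = bprod as" if "B \<in> normalized_finite_blaschke"
  proof -
    from that obtain cs where "\<forall>b\<in>set cs. norm b < 1" "B = bprod cs"
      unfolding normalized_finite_blaschke_def by blast
    with key [of cs 1] show ?thesis by simp
  qed
qed

text \<open>Bundles all claims about the left factor, so that the right factor is obtained from the
  same predicate for \<open>fps_sharp f\<close>. The purely spherical case is the one with an empty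
  chain.\<close>

definition canonical_left_factor :: "quat set \<Rightarrow> quat fps \<Rightarrow> quat fps \<Rightarrow> bool"
  where "canonical_left_factor V f B \<longleftrightarrow>
    B \<in> normalized_finite_blaschke \<and> left_blaschke_factor V f B \<and>
    (\<forall>B'\<in>normalized_finite_blaschke. left_blaschke_factor V f B' \<longrightarrow> B' = B) \<and>
    (\<forall>B'. left_blaschke_factor V f B' \<longrightarrow> (\<exists>u. norm u = 1 \<and> B' = B * fps_const u)) \<and>
    (\<forall>x p. V = {of_real x} \<and> real_zero_mult f x p \<longrightarrow> B = blaschke (of_real x) ^ p) \<and>
    (\<exists>as. spherical_chain V as \<and>
      int (length as) = int (sph_mult V (f * fps_sharp f)) - 2 * int (sph_mult V f) \<and>
      B = blaschke_class V ^ sph_mult V f * bprod as)"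

text \<open>For real \<open>x\<close>, the powers of \<open>fps_X - x\<close> and of
  \<open>blaschke x\<close> differ by a power of the central unit \<open>geom_inv x\<close>, which
  creates no zero at \<open>x\<close>.\<close>

lemma real_zero_mult_factorization:
  assumes "real_zero_mult f x p" "f \<in> schur_class" "\<bar>x\<bar> < 1"
  obtains h where "h \<in> schur_class" "\<not> has_zero_at h (of_real x)" "f = blaschke (of_real x) ^ p * h"
proof -
  define c :: quat where "c = of_real x"
  have c: "norm c < 1" "qcnj c = c" using assms by (simp_all add: c_def)
  obtain g where g: "g \<in> H1" "f = (fps_X - fps_const c) ^ p * g" "\<not> has_zero_at g c"
    using assms(1) by (auto simp: real_zero_mult_def c_def)
  have X_central: "(fps_X - fps_const c) * r = r * (fps_X - fps_const c)" for r
    by (rule fps_sharp_eq_imp_central) (simp add: fps_sharp_diff c)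
  have b_central: "blaschke c * r = r * blaschke c" for r
    by (rule fps_sharp_eq_imp_central) (simp add: fps_sharp_blaschke c)
  define h where "h = geom_inv c ^ p * g"
  have "(fps_X - fps_const c) ^ p = blaschke c ^ p * geom_inv c ^ p"
    using fps_X_minus_const_eq [of c] c power_mult_distrib_central [OF b_central, of "geom_inv c" p]
    by simp
  then have f: "f = blaschke c ^ p * h"
    using g by (simp add: h_def mult.assoc)
  have h: "h \<in> H1" using g by (simp add: h_def)
  have "\<not> has_zero_at h c"
  proof
    assume "has_zero_at h c"
    then obtain d where "d \<in> sim_class c" "eval_left h d = 0"
      using zero_imp_left_zero h by blast
    moreover from this have "d = c"
      by (auto simp: sim_class_def c_def mult.assoc simp flip: of_real_commute)
    ultimately have "eval_left h c = 0" by simp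
    then obtain q where q: "q \<in> H1" "h = (fps_X - fps_const c) * q"
      using eval_left_eq_0_iff h c by blast
    have geom_central: "geom c * r = r * geom c" for r
      by (rule fps_sharp_eq_imp_central) (simp add: fps_sharp_geom c)
    have "geom c ^ p * geom_inv c ^ p = 1"
      using power_mult_distrib_central [OF geom_central, of "geom_inv c" p]
      by (simp add: geometric_inverse)
    then have "g = geom c ^ p * h"
      by (simp add: h_def flip: mult.assoc)
    also have "\<dots> = (fps_X - fps_const c) * (geom c ^ p * q)"
      using X_central [of "geom c ^ p"] by (simp add: q(2) flip: mult.assoc)
    finally have "eval_left g c = 0"
      using eval_left_linear_factor [of "geom c ^ p * q" c] q c by simp
    then show False using g c by (simp add: has_zero_at_def)
  qed
  moreover have "h \<in> schur_class"
  proof (rule schur_bprod_cancel [of "replicate p c"])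
    show "bprod (replicate p c) * h \<in> schur_class"
      using assms f by (simp add: map_replicate prod_list_replicate)
  qed (use h c in auto)
  ultimately show ?thesis using f that unfolding c_def by blast
qed

lemma exists_canonical_left_factor:
  assumes f: "f \<in> schur_class" "f \<noteq> 0" and a: "norm a < 1"
  shows "\<exists>B. canonical_left_factor (sim_class a) f B"
proof -
  obtain cs h where cs: "spherical_chain (sim_class a) cs" and h: "h \<in> schur_class"
    "\<forall>c\<in>sim_class a. \<not> has_zero_at h c" and
    f_eq: "f = blaschke_class (sim_class a) ^ sph_mult (sim_class a) f * bprod cs * h"
    and len: "sph_mult (sim_class a) (f * fps_sharp f) = 2 * sph_mult (sim_class a) f + length cs"
    using spherical_factorization [OF f a] by metis
  define as where "as = concat (replicate (sph_mult (sim_class a) f) [a, qcnj a]) @ cs"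
  have B: "bprod as = blaschke_class (sim_class a) ^ sph_mult (sim_class a) f * bprod cs"
    by (simp only: as_def blaschke_class_power_eq_bprod map_append prod_list.append)
  then have f_eq: "f = bprod as * h" using f_eq by simp
  have as: "set as \<subseteq> sim_class a"
    using cs set_replicate_pair [of "sph_mult (sim_class a) f" a]
    by (simp only: as_def spherical_chain_def set_append) blast
  note norms = norm_less_1_if_subset_sim_class [OF as a]
  \<comment> \<open>A real class went through the same construction: there
    \<open>blaschke_class\<close> is the square of one factor and a chain has at most one entry. The
    expected power is identified by comparison with a constant list.\<close>
  have real: "bprod as = blaschke (of_real x) ^ p"
    if V: "sim_class a = {of_real x}" and mult: "real_zero_mult f x p" for x p
  proof -
    have "a = of_real x" using self_in_sim_class V by blast
    then have x: "\<bar>x\<bar> < 1" using a by simp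
    obtain k where k: "k \<in> schur_class" "\<not> has_zero_at k (of_real x)" "f = blaschke (of_real x) ^ p * k"
      using real_zero_mult_factorization [OF mult f(1) x] .
    have "bprod (replicate p (of_real x)) = bprod as"
    proof (rule conjunct1 [OF factorization_unique [OF a]])
      show "bprod (replicate p (of_real x)) * k = bprod as * h"
        using f_eq k by (simp add: map_replicate prod_list_replicate)
    qed (use k h as V in auto)
    then show ?thesis by (simp add: map_replicate prod_list_replicate)
  qed
  have normalized: "bprod as \<in> normalized_finite_blaschke"
    unfolding normalized_finite_blaschke_def using norms by blast
  have factor: "left_blaschke_factor (sim_class a) f (bprod as)"
    unfolding f_eq by (rule left_blaschke_factorI [OF as h a])
  note unique = left_blaschke_factor_unique [OF _ as h a, folded f_eq]
  have chain: "\<exists>cs. spherical_chain (sim_class a) cs \<and>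
      int (length cs) = int (sph_mult (sim_class a) (f * fps_sharp f)) - 2 * int (sph_mult (sim_class a) f) \<and>
      bprod as = blaschke_class (sim_class a) ^ sph_mult (sim_class a) f * bprod cs"
    by (intro exI [of _ cs] conjI cs B) (simp add: len)
  have "canonical_left_factor (sim_class a) f (bprod as)"
    unfolding canonical_left_factor_def using normalized factor unique real chain by blast
  then show ?thesis by blast
qed

lemma canonical_left_factor_spherical:
  assumes "canonical_left_factor V f B" "sph_mult V (f * fps_sharp f) = 2 * sph_mult V f"
  shows "B = blaschke_class V ^ sph_mult V f"
  using assms by (auto simp: canonical_left_factor_def)

lemma canonical_left_factor_chain:
  assumes "canonical_left_factor (sim_class a) f B" "norm a < 1"
    "int (sph_mult (sim_class a) (f * fps_sharp f)) - 2 * int (sph_mult (sim_class a) f) = int k"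
  shows "\<exists>!as. spherical_chain (sim_class a) as \<and> length as = k \<and>
    B = blaschke_class (sim_class a) ^ sph_mult (sim_class a) f * bprod as"
proof -
  obtain as where as: "spherical_chain (sim_class a) as" "length as = k"
    "B = blaschke_class (sim_class a) ^ sph_mult (sim_class a) f * bprod as"
    using assms by (auto simp: canonical_left_factor_def)
  show ?thesis
  proof (rule ex1I [of _ as])
    fix cs
    assume cs: "spherical_chain (sim_class a) cs \<and> length cs = k \<and>
      B = blaschke_class (sim_class a) ^ sph_mult (sim_class a) f * bprod cs"
    then have "bprod cs = bprod as"
      using as(3) by (simp add: blaschke_class_neq_0)
    with cs as assms show "cs = as" by (intro spherical_chain_unique) auto
  qed (use as in simp)
qed

section \<open>Transfer from left to right factors\<close>

lemma const_mult_blaschke: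
  assumes "norm u = 1"
  shows "fps_const u * blaschke a = blaschke (u * a * inverse u) * fps_const u"
proof -
  have u: "u \<noteq> 0" "inverse u = qcnj u"
    using assms by (auto simp: inverse_quat_def)
  define b where "b = u * a * inverse u"
  have bu: "b * u = u * a" using u(1) by (simp add: b_def mult.assoc)
  have "qcnj b * u = u * qcnj a * (inverse u * u)"
    by (simp add: b_def u(2) qcnj_mult mult.assoc)
  then have "qcnj b * u = u * qcnj a" using u(1) by simp
  then have pow: "qcnj b ^ k * u = u * qcnj a ^ k" for k
    by (induction k) (simp_all add: mult.assoc, simp flip: mult.assoc)
  have X: "fps_const u * (fps_X - fps_const a) = (fps_X - fps_const b) * fps_const u"
    by (simp add: left_diff_distrib right_diff_distrib bu fps_mult_fps_X_commute [of "fps_const u"])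
  have "fps_const u * geom (qcnj a) = geom (qcnj b) * fps_const u"
    by (rule fps_ext) (simp add: pow)
  then show ?thesis
    unfolding b_def [symmetric] blaschke_def by (metis X mult.assoc)
qed

text \<open>\<open>fps_sharp\<close> puts the unimodular constant of a finite Blaschke product in
  front. Moving it back to the end conjugates the zeros, which preserves their moduli.\<close>

lemma const_mult_bprod:
  "norm u = 1 \<Longrightarrow> fps_const u * bprod as = bprod (map (\<lambda>a. u * a * inverse u) as) * fps_const u"
proof (induction as)
  case (Cons b as)
  then show ?case
    using const_mult_blaschke [of u b] by simp (metis mult.assoc)
qed simp

lemma fps_sharp_finite_blaschke:
  assumes "B \<in> finite_blaschke"
  shows "fps_sharp B \<in> finite_blaschke"
proof -
  obtain as u where as: "B = bprod as * fps_const u" "\<forall>a\<in>set as. norm a < 1" "norm u = 1"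
    using assms by (auto simp: finite_blaschke_def)
  define v where "v = qcnj u"
  define cs where "cs = map (\<lambda>a. v * a * inverse v) (rev (map qcnj as))"
  have v: "norm v = 1" using as by (simp add: v_def)
  have "fps_sharp B = fps_const v * bprod (rev (map qcnj as))"
    by (simp only: as(1) fps_sharp_mult fps_sharp_bprod fps_sharp_simps v_def)
  also have "\<dots> = bprod cs * fps_const v"
    unfolding cs_def by (rule const_mult_bprod [OF v])
  finally show ?thesis
    unfolding finite_blaschke_def using as v
    by (intro CollectI exI [of _ cs] exI [of _ v])
      (auto simp: cs_def norm_mult norm_inverse)
qed

lemma fps_sharp_normalized_finite_blaschke:
  assumes "B \<in> normalized_finite_blaschke"
  shows "fps_sharp B \<in> normalized_finite_blaschke"
proof -
  obtain as where "B = bprod as" "\<forall>a\<in>set as. norm a < 1"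
    using assms by (auto simp: normalized_finite_blaschke_def)
  then show ?thesis
    unfolding normalized_finite_blaschke_def
    by (intro CollectI exI [of _ "rev (map qcnj as)"]) (auto simp: fps_sharp_bprod)
qed

lemma finite_blaschke_imp_H1: "B \<in> finite_blaschke \<Longrightarrow> B \<in> H1"
  by (auto simp: finite_blaschke_def H1_bprod)

lemma has_zero_at_sharp: "f \<in> H1 \<Longrightarrow> has_zero_at (fps_sharp f) c \<longleftrightarrow> has_zero_at f (qcnj c)"
  by (auto simp: has_zero_at_iff)

lemma no_zero_sharp:
  assumes "f \<in> H1" "\<forall>c\<in>sim_class a. \<not> has_zero_at f c"
  shows "\<forall>c\<in>sim_class a. \<not> has_zero_at (fps_sharp f) c"
  using assms qcnj_in_sim_class by (auto simp: has_zero_at_sharp)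

lemma zeros_sharp_subset:
  assumes "f \<in> H1" "{c. has_zero_at f c} \<subseteq> sim_class a"
  shows "{c. has_zero_at (fps_sharp f) c} \<subseteq> sim_class a"
proof
  fix c
  assume "c \<in> {c. has_zero_at (fps_sharp f) c}"
  then have "qcnj c \<in> sim_class a"
    using assms by (auto simp: has_zero_at_sharp)
  from qcnj_in_sim_class [OF this] show "c \<in> sim_class a" by simp
qed

lemma right_blaschke_factor_iff:
  "right_blaschke_factor (sim_class a) f B \<longleftrightarrow> left_blaschke_factor (sim_class a) (fps_sharp f) (fps_sharp B)"
proof
  assume R: "right_blaschke_factor (sim_class a) f B"
  then obtain G where "G \<in> schur_class" "\<forall>c\<in>sim_class a. \<not> has_zero_at G c" "f = G * B"
    by (auto simp: right_blaschke_factor_def)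
  with R show "left_blaschke_factor (sim_class a) (fps_sharp f) (fps_sharp B)"
    unfolding left_blaschke_factor_def right_blaschke_factor_def
    using fps_sharp_finite_blaschke zeros_sharp_subset [of B a] finite_blaschke_imp_H1 no_zero_sharp [of G a]
    by (intro conjI bexI [of _ "fps_sharp G"]) (auto simp only: fps_sharp_mult schur_sharp schur_imp_H1)
next
  assume L: "left_blaschke_factor (sim_class a) (fps_sharp f) (fps_sharp B)"
  then obtain H where H: "H \<in> schur_class" "\<forall>c\<in>sim_class a. \<not> has_zero_at H c" "fps_sharp f = fps_sharp B * H"
    by (auto simp: left_blaschke_factor_def)
  have B: "B \<in> finite_blaschke" "{c. has_zero_at B c} \<subseteq> sim_class a"
    using L fps_sharp_finite_blaschke [of "fps_sharp B"] zeros_sharp_subset [of "fps_sharp B" a]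
      finite_blaschke_imp_H1 [of "fps_sharp B"]
    by (auto simp only: left_blaschke_factor_def fps_sharp_sharp)
  have "f = fps_sharp H * B"
    using arg_cong [OF H(3), of fps_sharp] by (simp add: fps_sharp_mult)
  with B show "right_blaschke_factor (sim_class a) f B"
    unfolding right_blaschke_factor_def using H no_zero_sharp [of H a]
    by (intro conjI bexI [of _ "fps_sharp H"]) (auto simp only: schur_sharp schur_imp_H1)
qed

lemma sph_mult_sharp:
  assumes "norm a < 1"
  shows "sph_mult (sim_class a) (fps_sharp f) = sph_mult (sim_class a) f"
proof -
  have imp: "\<exists>g\<in>H1. fps_sharp f = blaschke_class (sim_class a) ^ k * g"
    if "g \<in> H1" "f = blaschke_class (sim_class a) ^ k * g" for f g k
  proof -
    have "fps_sharp f = blaschke_class (sim_class a) ^ k * fps_sharp g"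
      by (simp add: that(2) fps_sharp_mult fps_sharp_power fps_sharp_blaschke_class blaschke_class_power_central)
    then show ?thesis using that(1) H1_sharp by blast
  qed
  have "(\<exists>g\<in>H1. fps_sharp f = blaschke_class (sim_class a) ^ k * g) \<longleftrightarrow>
      (\<exists>g\<in>H1. f = blaschke_class (sim_class a) ^ k * g)" for k
    using imp by (metis fps_sharp_sharp)
  then show ?thesis by (simp add: sph_mult_eq_blaschke_class assms)
qed

lemma real_zero_mult_sharp:
  assumes "real_zero_mult f x p"
  shows "real_zero_mult (fps_sharp f) x p"
proof -
  obtain g where g: "g \<in> H1" "f = (fps_X - fps_const (of_real x)) ^ p * g" "\<not> has_zero_at g (of_real x)"
    using assms by (auto simp: real_zero_mult_def)
  have "(fps_X - fps_const (of_real x)) * r = r * (fps_X - fps_const (of_real x))" for r :: "quat fps"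
    by (rule fps_sharp_eq_imp_central) (simp add: fps_sharp_diff)
  from power_commuting_commutes [OF this]
  have "fps_sharp f = (fps_X - fps_const (of_real x)) ^ p * fps_sharp g"
    by (simp add: g(2) fps_sharp_mult fps_sharp_power fps_sharp_diff)
  moreover have "\<not> has_zero_at (fps_sharp g) (of_real x)"
    using g by (simp add: has_zero_at_sharp)
  ultimately show ?thesis
    unfolding real_zero_mult_def using g(1) by (intro bexI [of _ "fps_sharp g"]) simp_all
qed

theorem theorem3p9:
  fixes f :: "quat fps" and V :: "quat set"
  assumes "f \<in> schur_class" and "f \<noteq> 0"
    and "\<exists>a. V = sim_class a" and "V \<subseteq> ball 0 1"
    and "\<exists>c\<in>V. has_zero_at f c"
  shows "\<exists>Bl Br.
    Bl \<in> normalized_finite_blaschke \<and> Br \<in> normalized_finite_blaschke \<and>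
    left_blaschke_factor V f Bl \<and> right_blaschke_factor V f Br \<and>
    (\<forall>B\<in>normalized_finite_blaschke. left_blaschke_factor V f B \<longrightarrow> B = Bl) \<and>
    (\<forall>B\<in>normalized_finite_blaschke. right_blaschke_factor V f B \<longrightarrow> B = Br) \<and>
    (\<forall>B. left_blaschke_factor V f B \<longrightarrow> (\<exists>u. norm u = 1 \<and> B = Bl * fps_const u)) \<and>
    (\<forall>B. right_blaschke_factor V f B \<longrightarrow> (\<exists>u. norm u = 1 \<and> B = fps_const u * Br)) \<and>
    (\<forall>x p. V = {of_real x} \<and> real_zero_mult f x p \<longrightarrow>
       Bl = blaschke (of_real x) ^ p \<and> Br = blaschke (of_real x) ^ p) \<and>
    (\<forall>\<kappa>. nonreal_class V \<and> sph_mult V f = \<kappa> \<and>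
         sph_mult V (f * fps_sharp f) = 2 * \<kappa> \<and> 2 * \<kappa> > 0 \<longrightarrow>
       Bl = blaschke_class V ^ \<kappa> \<and> Br = blaschke_class V ^ \<kappa>) \<and>
    (\<forall>\<kappa> k. nonreal_class V \<and> sph_mult V f = \<kappa> \<and>
         int (sph_mult V (f * fps_sharp f)) - 2 * int (sph_mult V f) = int k \<and> k > 0 \<longrightarrow>
       (\<exists>!as. spherical_chain V as \<and> length as = k \<and>
          Bl = blaschke_class V ^ \<kappa> * prod_list (map blaschke as)) \<and>
       (\<exists>!as. spherical_chain V as \<and> length as = k \<and>
          Br = prod_list (map blaschke (rev as)) * blaschke_class V ^ \<kappa>))"
proof -
  obtain a where V: "V = sim_class a" using assms(3) by blast
  with assms(4) have a: "norm a < 1" using self_in_sim_class [of a] by auto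
  obtain Bl where Bl: "canonical_left_factor V f Bl"
    unfolding V using exists_canonical_left_factor [OF assms(1,2) a] by blast
  obtain B where B: "canonical_left_factor V (fps_sharp f) B"
    unfolding V using exists_canonical_left_factor [of "fps_sharp f" a] assms(1,2) a by auto
  define Br where "Br = fps_sharp B"
  have B_eq: "B = fps_sharp Br" by (simp add: Br_def)
  have sharp_eq: "fps_sharp g = h \<longleftrightarrow> g = fps_sharp h" for g h by auto
  have series: "fps_sharp f * fps_sharp (fps_sharp f) = f * fps_sharp f"
    by (simp add: fps_sharp_mult_self)
  note mult = sph_mult_sharp [OF a, folded V]
  note right_iff = right_blaschke_factor_iff [of a, folded V]
  have power_sharp: "fps_sharp (blaschke_class V ^ n) = blaschke_class V ^ n" for n
    by (simp add: V fps_sharp_power fps_sharp_blaschke_class)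
  have r1: "Br \<in> normalized_finite_blaschke"
    using B fps_sharp_normalized_finite_blaschke unfolding Br_def canonical_left_factor_def by blast
  have r2: "right_blaschke_factor V f Br"
    using B by (simp add: right_iff canonical_left_factor_def Br_def)
  have r3: "B' = Br" if "B' \<in> normalized_finite_blaschke" "right_blaschke_factor V f B'" for B'
  proof -
    have "fps_sharp B' = B"
      using that B fps_sharp_normalized_finite_blaschke [of B']
      unfolding right_iff canonical_left_factor_def by blast
    then show ?thesis by (auto simp: Br_def)
  qed
  have r4: "\<exists>u. norm u = 1 \<and> B' = fps_const u * Br" if B': "right_blaschke_factor V f B'" for B'
  proof -
    obtain u where "norm u = 1" "fps_sharp B' = B * fps_const u"
      using B' B unfolding right_iff canonical_left_factor_def by blast
    moreover from arg_cong [OF this(2), of fps_sharp] have "B' = fps_const (qcnj u) * Br"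
      by (simp add: fps_sharp_mult Br_def)
    ultimately show ?thesis
      by (intro exI [of _ "qcnj u"]) simp
  qed
  have real: "Bl = blaschke (of_real x) ^ p \<and> Br = blaschke (of_real x) ^ p"
    if "V = {of_real x}" "real_zero_mult f x p" for x p
  proof
    show "Bl = blaschke (of_real x) ^ p"
      using Bl that by (auto simp: canonical_left_factor_def)
    have "B = blaschke (of_real x) ^ p"
      using B that real_zero_mult_sharp by (auto simp: canonical_left_factor_def)
    then show "Br = blaschke (of_real x) ^ p"
      by (simp add: Br_def fps_sharp_power fps_sharp_blaschke)
  qed
  have spherical: "Bl = blaschke_class V ^ sph_mult V f \<and> Br = blaschke_class V ^ sph_mult V f"
    if "sph_mult V (f * fps_sharp f) = 2 * sph_mult V f"
    using canonical_left_factor_spherical [OF Bl that] canonical_left_factor_spherical [OF B, unfolded series mult, OF that]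
    by (simp add: Br_def power_sharp)
  have chain: "(\<exists>!as. spherical_chain V as \<and> length as = k \<and>
          Bl = blaschke_class V ^ sph_mult V f * bprod as) \<and>
       (\<exists>!as. spherical_chain V as \<and> length as = k \<and>
          Br = bprod (rev as) * blaschke_class V ^ sph_mult V f)"
    if k: "int (sph_mult V (f * fps_sharp f)) - 2 * int (sph_mult V f) = int k" for k
  proof
    show "\<exists>!as. spherical_chain V as \<and> length as = k \<and>
        Bl = blaschke_class V ^ sph_mult V f * bprod as"
      using canonical_left_factor_chain [OF _ a] Bl k unfolding V by blast
    \<comment> \<open>\<open>P\<close> describes the chain of the left factor of
      \<open>fps_sharp f\<close>. Conjugating its entries is an involution on chains, so existence
      and uniqueness carry over; \<open>fps_sharp\<close> then accounts for the reversed order in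
      \<open>Br\<close>.\<close>
    define P where "P = (\<lambda>as. spherical_chain V as \<and> length as = k \<and>
      B = blaschke_class V ^ sph_mult V f * bprod as)"
    have "\<exists>!as. P as"
      using canonical_left_factor_chain [OF B [unfolded V] a, of k, folded V, unfolded series mult, OF k]
      unfolding P_def .
    then have "\<exists>!as. P (map qcnj as)"
    proof (elim ex1E, intro ex1I)
      fix as cs
      assume as: "P as" "\<forall>bs. P bs \<longrightarrow> bs = as"
      show "P (map qcnj (map qcnj as))" using as(1) by (simp add: comp_def)
      assume "P (map qcnj cs)"
      then have "map qcnj cs = as" using as(2) by blast
      then show "cs = map qcnj as" by (auto simp: comp_def)
    qed
    moreover have "P (map qcnj as) \<longleftrightarrow> spherical_chain V as \<and> length as = k \<and>
        Br = bprod (rev as) * blaschke_class V ^ sph_mult V f" for as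
    proof -
      have "B = blaschke_class V ^ sph_mult V f * bprod (map qcnj as) \<longleftrightarrow>
          Br = bprod (rev as) * blaschke_class V ^ sph_mult V f"
        unfolding B_eq sharp_eq fps_sharp_mult power_sharp fps_sharp_bprod by (simp add: comp_def)
      then show ?thesis by (simp add: P_def V spherical_chain_map_qcnj)
    qed
    ultimately show "\<exists>!as. spherical_chain V as \<and> length as = k \<and>
        Br = bprod (rev as) * blaschke_class V ^ sph_mult V f" by simp
  qed
  show ?thesis
  proof (rule exI [of _ Bl], rule exI [of _ Br], intro conjI)
    show "Bl \<in> normalized_finite_blaschke" "left_blaschke_factor V f Bl"
      "\<forall>B\<in>normalized_finite_blaschke. left_blaschke_factor V f B \<longrightarrow> B = Bl"
      "\<forall>B. left_blaschke_factor V f B \<longrightarrow> (\<exists>u. norm u = 1 \<and> B = Bl * fps_const u)"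
      using Bl unfolding canonical_left_factor_def by blast+
    show "Br \<in> normalized_finite_blaschke" "right_blaschke_factor V f Br"
      by (fact r1, fact r2)
    show "\<forall>B\<in>normalized_finite_blaschke. right_blaschke_factor V f B \<longrightarrow> B = Br"
      by (intro ballI impI) (rule r3)
    show "\<forall>B. right_blaschke_factor V f B \<longrightarrow> (\<exists>u. norm u = 1 \<and> B = fps_const u * Br)"
      by (intro allI impI) (rule r4)
  qed ((intro allI impI, elim conjE, rule real; assumption),
      (intro allI impI, elim conjE, hypsubst, rule spherical; assumption),
      (intro allI impI, elim conjE, hypsubst, rule chain; assumption))
qed

end
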